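(* Let $\mathcal C\subset\mathcal W$ be a set of solitary waves such that $\tau(\mathcal C)$ is a connected subset of $(C^0_{\mathrm{bdd}}[0,\infty))^7$ (topology of uniform convergence). If $\mathcal C$ contains at least one trivial wave, and if all the waves in $\mathcal C$ satisfy $$ g-\gamma(0)\,u_\infty(0)>0, $$ then for every wave in $\mathcal C$ the slope $|v/u|$ of every streamline is $<1$ everywhere in $\overline\Omega$.
   Context: Fix constants $g>0$ and $P_{\mathrm{atm}}$. A solitary wave is a tuple $(u,v,P,\eta,u_\infty,d)$ with $d>0$, $\eta\in C^4_{\mathrm{bdd}}(\mathbb R)$, $u_\infty\in C^3[-d,0]$, $u,v,P\in C^3_{\mathrm{bdd}}(\overline\Omega)$ (bounded continuous derivatives up to the given order), where $\Omega=\{(x,y):x\in\mathbb R,\ -d<y<\eta(x)\}$, with $u,P,\eta$ even in $x$ and $v$ odd in $x$, satisfying $uu_x+vu_y=-P_x$, $uv_x+vv_y=-P_y-g$, $u_x+v_y=0$ in $\Omega$; $P=P_{\mathrm{atm}}$ and $v=\eta_xu$ on $y=\eta(x)$; $v=0$ on $y=-d$; and, uniformly in $y$, $D^kv\to0$, $\eta\to0$, $D^ku(x,y)\to D^ku_\infty(y)$ as $x\to\pm\infty$ for $k=0,1,2$ ($D^k$ any derivative of order $k$). It is assumed that $\sup_\Omega u<0$. There is then a stream function $\psi$ with $\psi_y=u$, $\psi_x=-v$, $\psi=0$ on the free surface, $\psi=m>0$ on $y=-d$, and a vorticity function $\gamma\in C^2[0,m]$ with $v_x-u_y=\gamma(\psi)$;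 it is assumed $\gamma\le0,\gamma'\le0,\gamma''\le0$ on $(0,m)$. A wave is trivial if $u,v,\eta,P$ depend only on $y$. Let $\Omega^+=\{x>0,\ -d<y<\eta(x)\}$, $S^+=\{(x,\eta(x)):x>0\}$. A wave is monotone if $v>0$ in $\Omega^+\cup S^+$. $\mathcal W$ is the set of such solitary waves that are monotone or trivial. The map $\tau:\mathcal W\to(C^0_{\mathrm{bdd}}[0,\infty))^7$ is $\tau(u,v,P,\eta,u_\infty,d)(x)=(u,v,u_x,v_x,u_y,u_{xx},u_{xy})(x,\eta(x))$. *)

theory Defs
  imports "HOL-Analysis.Analysis"
begin

record wave =
  wu    :: "real \<Rightarrow> real \<Rightarrow> real"
  wv    :: "real \<Rightarrow> real \<Rightarrow> real"
  wP    :: "real \<Rightarrow> real \<Rightarrow> real"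
  weta  :: "real \<Rightarrow> real"
  wuinf :: "real \<Rightarrow> real"
  wd    :: real

definition Om :: "wave \<Rightarrow> (real \<times> real) set" where
  "Om w = {p. - wd w < snd p \<and> snd p < weta w (fst p)}"

definition Ck_fam ::
  "nat \<Rightarrow> (real \<times> real) set \<Rightarrow> (real \<Rightarrow> real \<Rightarrow> real) \<Rightarrow> (nat \<Rightarrow> nat \<Rightarrow> real \<Rightarrow> real \<Rightarrow> real) \<Rightarrow> bool"
  where
  "Ck_fam k S f D \<longleftrightarrow>
     D 0 0 = f \<and>
     (\<forall>i j. i + j < k \<longrightarrow>
        (\<forall>x y. (x, y) \<in> S \<longrightarrow>
           ((\<lambda>t. D i j t y) has_real_derivative D (Suc i) j x y) (at x) \<and>
           ((\<lambda>s. D i j x s) has_real_derivative D i (Suc j) x y) (at y))) \<and>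
     (\<forall>i j. i + j \<le> k \<longrightarrow>
        continuous_on (closure S) (\<lambda>p. D i j (fst p) (snd p)) \<and>
        bounded ((\<lambda>p. D i j (fst p) (snd p)) ` closure S))"

text \<open>The (canonical) partial derivatives of f on closure S; they are uniquely
  determined on closure S whenever some C^k family exists.\<close>
definition cpd ::
  "nat \<Rightarrow> (real \<times> real) set \<Rightarrow> (real \<Rightarrow> real \<Rightarrow> real) \<Rightarrow> nat \<Rightarrow> nat \<Rightarrow> real \<Rightarrow> real \<Rightarrow> real"
  where "cpd k S f = (SOME D. Ck_fam k S f D)"

definition Ck_int :: "nat \<Rightarrow> real \<Rightarrow> real \<Rightarrow> (real \<Rightarrow> real) \<Rightarrow> (nat \<Rightarrow> real \<Rightarrow> real) \<Rightarrow> bool"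
  where
  "Ck_int k a b f D \<longleftrightarrow>
     D 0 = f \<and>
     (\<forall>j < k. \<forall>y \<in> {a..b}. (D j has_real_derivative D (Suc j) y) (at y within {a..b})) \<and>
     (\<forall>j \<le> k. continuous_on {a..b} (D j))"

definition cid :: "nat \<Rightarrow> real \<Rightarrow> real \<Rightarrow> (real \<Rightarrow> real) \<Rightarrow> nat \<Rightarrow> real \<Rightarrow> real"
  where "cid k a b f = (SOME D. Ck_int k a b f D)"

definition Ck_bdd_R :: "nat \<Rightarrow> (real \<Rightarrow> real) \<Rightarrow> bool" where
  "Ck_bdd_R k f \<longleftrightarrow>
     (\<forall>j < k. \<forall>x. ((deriv ^^ j) f has_real_derivative (deriv ^^ Suc j) f x) (at x)) \<and>
     (\<forall>j \<le> k. continuous_on UNIV ((deriv ^^ j) f) \<and> bounded (range ((deriv ^^ j) f)))"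

definition solitary_wave :: "real \<Rightarrow> real \<Rightarrow> wave \<Rightarrow> bool" where
  "solitary_wave g Patm w \<longleftrightarrow>
    (let u = wu w; v = wv w; P = wP w; \<eta> = weta w; ui = wuinf w; d = wd w; \<Omega> = Om w;
         Du = cpd 3 \<Omega> u; Dv = cpd 3 \<Omega> v; DP = cpd 3 \<Omega> P; Dui = cid 3 (-d) 0 ui in
     d > 0 \<and>
     Ck_bdd_R 4 \<eta> \<and>
     (\<exists>D. Ck_int 3 (-d) 0 ui D) \<and>
     (\<exists>D. Ck_fam 3 \<Omega> u D) \<and> (\<exists>D. Ck_fam 3 \<Omega> v D) \<and> (\<exists>D. Ck_fam 3 \<Omega> P D) \<and>
     \<comment> \<open>symmetry\<close>
     (\<forall>x. \<eta> (-x) = \<eta> x) \<and>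
     (\<forall>x y. (x, y) \<in> closure \<Omega> \<longrightarrow>
        u (-x) y = u x y \<and> P (-x) y = P x y \<and> v (-x) y = - v x y) \<and>
     \<comment> \<open>Euler equations and incompressibility\<close>
     (\<forall>x y. (x, y) \<in> \<Omega> \<longrightarrow>
        u x y * Du 1 0 x y + v x y * Du 0 1 x y = - DP 1 0 x y \<and>
        u x y * Dv 1 0 x y + v x y * Dv 0 1 x y = - DP 0 1 x y - g \<and>
        Du 1 0 x y + Dv 0 1 x y = 0) \<and>
     \<comment> \<open>boundary conditions\<close>
     (\<forall>x. P x (\<eta> x) = Patm \<and> v x (\<eta> x) = deriv \<eta> x * u x (\<eta> x)) \<and>
     (\<forall>x. v x (-d) = 0) \<and>
     \<comment> \<open>asymptotics, uniformly in y\<close>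
     (\<forall>e>0. \<exists>R. \<forall>x y i j. \<bar>x\<bar> > R \<and> (x, y) \<in> closure \<Omega> \<and> i + j \<le> 2 \<longrightarrow>
        \<bar>Dv i j x y\<bar> < e) \<and>
     (\<forall>e>0. \<exists>R. \<forall>x y i j. \<bar>x\<bar> > R \<and> (x, y) \<in> closure \<Omega> \<and> y \<le> 0 \<and> i + j \<le> 2 \<longrightarrow>
        \<bar>Du i j x y - (if i = 0 then Dui j y else 0)\<bar> < e) \<and>
     (\<eta> \<longlongrightarrow> 0) at_infinity \<and>
     \<comment> \<open>standing assumption sup u < 0\<close>
     (\<exists>c<0. \<forall>p \<in> \<Omega>. u (fst p) (snd p) \<le> c))"

definition stream_vort :: "wave \<Rightarrow> (real \<Rightarrow> real \<Rightarrow> real) \<Rightarrow> real \<Rightarrow> (real \<Rightarrow> real) \<Rightarrow> bool" where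
  "stream_vort w \<psi> m \<gamma> \<longleftrightarrow>
    (let u = wu w; v = wv w; \<Omega> = Om w; Du = cpd 3 \<Omega> u; Dv = cpd 3 \<Omega> v in
     m > 0 \<and>
     continuous_on (closure \<Omega>) (\<lambda>p. \<psi> (fst p) (snd p)) \<and>
     (\<forall>x y. (x, y) \<in> \<Omega> \<longrightarrow>
        ((\<lambda>s. \<psi> x s) has_real_derivative u x y) (at y) \<and>
        ((\<lambda>t. \<psi> t y) has_real_derivative - v x y) (at x)) \<and>
     (\<forall>x. \<psi> x (weta w x) = 0 \<and> \<psi> x (- wd w) = m) \<and>
     (\<exists>D. Ck_int 2 0 m \<gamma> D) \<and>
     (\<forall>x y. (x, y) \<in> \<Omega> \<longrightarrow> Dv 1 0 x y - Du 0 1 x y = \<gamma> (\<psi> x y)))"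

definition vort_signs :: "real \<Rightarrow> (real \<Rightarrow> real) \<Rightarrow> bool" where
  "vort_signs m \<gamma> \<longleftrightarrow>
     (\<forall>s \<in> {0<..<m}. \<gamma> s \<le> 0 \<and> deriv \<gamma> s \<le> 0 \<and> deriv (deriv \<gamma>) s \<le> 0)"

definition trivial_wave :: "wave \<Rightarrow> bool" where
  "trivial_wave w \<longleftrightarrow>
     (\<forall>x x'. weta w x = weta w x') \<and>
     (\<forall>x x' y. (x, y) \<in> closure (Om w) \<and> (x', y) \<in> closure (Om w) \<longrightarrow>
        wu w x y = wu w x' y \<and> wv w x y = wv w x' y \<and> wP w x y = wP w x' y)"

definition monotone_wave :: "wave \<Rightarrow> bool" where
  "monotone_wave w \<longleftrightarrow>
     (\<forall>x y. x > 0 \<and> ((x, y) \<in> Om w \<or> y = weta w x) \<longrightarrow> wv w x y > 0)"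

definition Wcal :: "real \<Rightarrow> real \<Rightarrow> wave set" where
  "Wcal g Patm = {w. solitary_wave g Patm w \<and>
      (\<exists>\<psi> m \<gamma>. stream_vort w \<psi> m \<gamma> \<and> vort_signs m \<gamma>) \<and>
      (monotone_wave w \<or> trivial_wave w)}"

text \<open>The map tau into (C^0_bdd[0,oo))^7.  A function on [0,oo) is
  represented by its extension x \<mapsto> f (max 0 x) in C_bdd(R); this is an
  isometric embedding for the sup metric, so topology is preserved.\<close>
type_synonym tau_val = "real \<times> real \<times> real \<times> real \<times> real \<times> real \<times> real"

definition tau :: "wave \<Rightarrow> (real, tau_val) bcontfun" where
  "tau w = Bcontfun (\<lambda>x.
     (let s = max 0 x; h = weta w s; Du = cpd 3 (Om w) (wu w); Dv = cpd 3 (Om w) (wv w) in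
      (Du 0 0 s h, Dv 0 0 s h, Du 1 0 s h, Dv 1 0 s h, Du 0 1 s h, Du 2 0 s h, Du 1 1 s h)))"

end

theory Submission
  imports Defs
begin

text \<open>
  Let K = g + u (u_y + v_x) and N = u^2 - v^2 on the free surface. Since the pressure is constant
  there, N u_x = - v K. The property "K > 0 and N > 0 for x >= 0" depends only on the image of the wave
  under tau. It holds for trivial waves, and it is open because the hypothesis g - gamma(0) u_inf(0) > 0 is
  positivity of the limit of K at infinity. It is also closed. For a monotone wave with K >= 0 and N >= 0 one
  gets u_x <= 0 on the surface, hence everywhere in x > 0 by the weak maximum principle, because u_x is a
  subsolution: Laplace(u_x) + gamma'(psi) u_x = gamma''(psi) u v >= 0. Were u_x to vanish at a surface point
  with x > 0, then K would have a zero minimum there, but the sign information on the second derivatives of u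
  forces K' < 0; at the crest the same argument applies to K''. Hence u_x < 0, so K > 0, and N = 0 is excluded
  because a point of steepest slope -1 has u_x = - gamma(0)/2 >= 0. By connectedness |v/u| < 1 on every surface,
  and this extends inwards because v/u satisfies an elliptic equation without zeroth-order term.
\<close>

section \<open>Maximum principle and boundary derivatives\<close>

text \<open>The derivatives supplied by \<open>Ck_fam\<close> exist in the open domain and extend
  continuously to its closure, so every statement on the surface comes from derivatives along it or
  from one-sided tests. These give u_xy >= 0 without strictness where u_x touches zero. Strictness
  comes from gravity: K = 0 forces u (2 u_y + \<gamma>(0)) = -g < 0, hence a strictly negative term
  in K' off the crest and in K'' at the crest. The identity N u_x = - v K fails to determine u_x in
  two places. Where N = 0 it says nothing; but all such points with x > 0 share one value of u_x,
  and the first of them inherits u_x \<le> 0 by continuity. At the crest both sides vanish, so the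
  identity is differentiated once more. The argument there also needs \<eta>''(0) < 0, which follows
  from the hypothesis on the flow at infinity, carried to the crest by Bernoulli's law. The
  half-line is not compact: pointwise positivity of K and N becomes stable under uniform
  perturbation only through their positive limits at infinity.\<close>

lemma left_deriv_at_max:
  fixes f f' :: "real \<Rightarrow> real"
  assumes "a < b" and f: "continuous_on {a..b} f" and f': "continuous_on {a..b} f'"
    and d: "\<And>y. a < y \<Longrightarrow> y < b \<Longrightarrow> (f has_real_derivative f' y) (at y)"
    and le: "\<And>y. a < y \<Longrightarrow> y < b \<Longrightarrow> f y \<le> f b"
  shows "0 \<le> f' b"
proof (rule ccontr)
  assume "\<not> 0 \<le> f' b"
  then have neg: "f' b < 0" by simp
  have "(f' \<longlongrightarrow> f' b) (at b within {a..b})"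
    using f' \<open>a < b\<close> by (auto simp: continuous_on_def)
  then have "\<forall>\<^sub>F y in at b within {a..b}. f' y < 0"
    using neg by (rule order_tendstoD)
  then obtain e where e: "e > 0" "\<And>y. y \<in> {a..b} \<Longrightarrow> y \<noteq> b \<Longrightarrow> dist y b < e \<Longrightarrow> f' y < 0"
    by (auto simp: eventually_at)
  define c where "c = max ((a + b) / 2) (b - e / 2)"
  have c: "a < c" "c < b" "b - e < c" using \<open>a < b\<close> e(1) by (auto simp: c_def max_def)
  have "f b < f c"
  proof (rule DERIV_neg_imp_decreasing_open[OF c(2)])
    fix y assume "c < y" "y < b"
    then show "\<exists>z. (f has_real_derivative z) (at y) \<and> z < 0"
      using d[of y] e(2)[of y] c by (auto simp: dist_real_def)
  qed (rule continuous_on_subset[OF f], use c in auto)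
  then show False using le[of c] c by simp
qed

lemma right_deriv_at_min:
  fixes f f' :: "real \<Rightarrow> real"
  assumes "a < b" and f: "continuous_on {a..b} f" and f': "continuous_on {a..b} f'"
    and d: "\<And>y. a < y \<Longrightarrow> y < b \<Longrightarrow> (f has_real_derivative f' y) (at y)"
    and le: "\<And>y. a < y \<Longrightarrow> y < b \<Longrightarrow> f a \<le> f y"
  shows "0 \<le> f' a"
proof -
  have *: "0 \<le> f' (- (- a))"
  proof (rule left_deriv_at_max[where f = "\<lambda>y. - f (- y)" and f' = "\<lambda>y. f' (- y)" and a = "-b"])
    show "continuous_on {- b..- a} (\<lambda>y. - f (- y))"
      by (intro continuous_intros continuous_on_compose2[OF f]) auto
    show "continuous_on {- b..- a} (\<lambda>y. f' (- y))"
      by (intro continuous_intros continuous_on_compose2[OF f']) auto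
    fix y assume y: "- b < y" "y < - a"
    have "((\<lambda>y. f (- y)) has_real_derivative f' (- y) * (- 1)) (at y)"
      by (rule DERIV_chain2[where f = f and g = uminus]) (use d[of "- y"] y in \<open>auto intro!: derivative_eq_intros\<close>)
    from DERIV_minus[OF this] show "((\<lambda>y. - f (- y)) has_real_derivative f' (- y)) (at y)" by simp
    show "- f (- y) \<le> - f (- (- a))" using le[of "- y"] y by simp
  qed (use \<open>a < b\<close> in simp)
  then show ?thesis by simp
qed

text \<open>If l < 0 then f' is negative just to the right of x, so f decreases there. The one-sided
  form is what the crest requires, since K \<ge> 0 is assumed for x \<ge> 0 only.\<close>

lemma right_second_deriv_at_min:
  fixes f f' :: "real \<Rightarrow> real"
  assumes "x < b"
    and d: "\<And>y. x \<le> y \<Longrightarrow> y < b \<Longrightarrow> (f has_real_derivative f' y) (at y)"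
    and f'0: "f' x = 0" and dd: "(f' has_real_derivative l) (at x)"
    and le: "\<And>y. x < y \<Longrightarrow> y < b \<Longrightarrow> f x \<le> f y"
  shows "0 \<le> l"
proof (rule ccontr)
  assume "\<not> 0 \<le> l"
  then obtain e where e: "e > 0" "\<And>h. h > 0 \<Longrightarrow> h < e \<Longrightarrow> f' (x + h) < f' x"
    using DERIV_neg_dec_right[OF dd] by auto
  define c where "c = x + min (e / 2) ((b - x) / 2)"
  have c: "x < c" "c < b" "c < x + e" using \<open>x < b\<close> e(1) by (auto simp: c_def min_def field_simps)
  have "f c < f x"
  proof (rule DERIV_neg_imp_decreasing_open[OF c(1)])
    fix y assume y: "x < y" "y < c"
    then show "\<exists>z. (f has_real_derivative z) (at y) \<and> z < 0"
      using d[of y] e(2)[of "y - x"] c f'0 by auto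
  next
    show "continuous_on {x..c} f"
    proof (rule DERIV_continuous_on)
      fix y assume "y \<in> {x..c}"
      then show "(f has_real_derivative f' y) (at y within {x..c})"
        using d[of y] c by (auto intro: has_field_derivative_at_within)
    qed
  qed
  then show False using le[of c] c by simp
qed

lemma deriv_tests_at_max:
  fixes f f' :: "real \<Rightarrow> real"
  assumes "open S" "x \<in> S"
    and d: "\<And>y. y \<in> S \<Longrightarrow> (f has_real_derivative f' y) (at y)"
    and dd: "(f' has_real_derivative l) (at x)"
    and le: "\<And>y. y \<in> S \<Longrightarrow> f y \<le> f x"
  shows "f' x = 0" "l \<le> 0"
proof -
  obtain e where e: "e > 0" "\<And>y. \<bar>x - y\<bar> < e \<Longrightarrow> y \<in> S"
    using assms(1,2) unfolding open_dist by (auto simp: dist_real_def abs_minus_commute)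
  show f'0: "f' x = 0" using DERIV_local_max[OF d[OF assms(2)] e(1)] le e(2) by auto
  have "0 \<le> - l"
    by (rule right_second_deriv_at_min[where f = "\<lambda>y. - f y" and f' = "\<lambda>y. - f' y" and x = x and b = "x + e"])
      (use e f'0 le in \<open>auto intro!: derivative_intros d dd\<close>)
  then show "l \<le> 0" by simp
qed

text \<open>Asking for the differential inequality only where f > 0 absorbs a zeroth-order term of
  favourable sign. The perturbation depends on y alone, so fx vanishes at the perturbed maximum and
  \<open>b\<close> may be arbitrary; the coefficient of fy has to be dominated by
  \<open>l\<close>.\<close>

lemma weak_max_principle:
  fixes f fx fy fxx fyy a b :: "real \<Rightarrow> real \<Rightarrow> real" and \<eta> :: "real \<Rightarrow> real" and d :: real
  defines "G \<equiv> \<lambda>x y. 0 < x \<and> - d < y \<and> y < \<eta> x"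
  assumes \<eta>: "continuous_on UNIV \<eta>" and H: "\<And>x. \<eta> x \<le> H"
    and cont: "continuous_on {p. 0 \<le> fst p \<and> - d \<le> snd p \<and> snd p \<le> \<eta> (fst p)} (\<lambda>p. f (fst p) (snd p))"
    and dx: "\<And>x y. G x y \<Longrightarrow> ((\<lambda>t. f t y) has_real_derivative fx x y) (at x)"
    and dy: "\<And>x y. G x y \<Longrightarrow> ((\<lambda>s. f x s) has_real_derivative fy x y) (at y)"
    and dxx: "\<And>x y. G x y \<Longrightarrow> ((\<lambda>t. fx t y) has_real_derivative fxx x y) (at x)"
    and dyy: "\<And>x y. G x y \<Longrightarrow> ((\<lambda>s. fy x s) has_real_derivative fyy x y) (at y)"
    and bdry: "\<And>x y. 0 \<le> x \<Longrightarrow> - d \<le> y \<Longrightarrow> y \<le> \<eta> x \<Longrightarrow> x = 0 \<or> y = - d \<or> y = \<eta> x \<Longrightarrow> f x y \<le> 0"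
    and inf: "\<And>e. e > 0 \<Longrightarrow> \<exists>R. \<forall>x y. R < x \<and> - d \<le> y \<and> y \<le> \<eta> x \<longrightarrow> f x y \<le> e"
    and op: "\<And>x y. G x y \<Longrightarrow> f x y > 0 \<Longrightarrow> 0 \<le> fxx x y + fyy x y + b x y * fx x y + a x y * fy x y"
    and abnd: "\<And>x y. G x y \<Longrightarrow> \<bar>a x y\<bar> \<le> A"
    and x0: "0 \<le> x0" and y0: "- d \<le> y0" "y0 \<le> \<eta> x0"
  shows "f x0 y0 \<le> 0"
proof (rule ccontr)
  assume "\<not> f x0 y0 \<le> 0"
  then have pos: "f x0 y0 > 0" by simp
  define Q where "Q = {p. 0 \<le> fst p \<and> - d \<le> snd p \<and> snd p \<le> \<eta> (fst p)}"
  \<comment> \<open>The summand 1 makes \<open>l\<close> positive and strictly larger than the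
    coefficient of fy.\<close>
  define l where "l = \<bar>A\<bar> + 1"
  have l: "l > 0" "\<And>x y. G x y \<Longrightarrow> \<bar>a x y\<bar> < l" using abnd by (force simp: l_def)+
  \<comment> \<open>With this size the perturbation costs less than half of f x0 y0, so
    \<open>h\<close> still exceeds f x0 y0 / 2 at (x0, y0), while f is at most that far out.\<close>
  define \<epsilon> where "\<epsilon> = f x0 y0 / (2 * exp (l * H))"
  have \<epsilon>: "\<epsilon> > 0" using pos by (simp add: \<epsilon>_def)
  \<comment> \<open>The perturbation makes the differential inequality strict at a maximum of h.\<close>
  define h where "h x y = f x y + \<epsilon> * (exp (l * y) - exp (l * H))" for x y
  have hf: "h x y \<le> f x y" if "y \<le> \<eta> x" for x y
  proof -
    have "exp (l * y) \<le> exp (l * H)" using that H[of x] l(1) by simp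
    then show ?thesis using \<epsilon> by (auto simp: h_def mult_le_0_iff)
  qed
  have "h x0 y0 > f x0 y0 - \<epsilon> * exp (l * H)" using \<epsilon> by (simp add: h_def algebra_simps)
  also have "f x0 y0 - \<epsilon> * exp (l * H) = f x0 y0 / 2" by (simp add: \<epsilon>_def)
  finally have h0: "h x0 y0 > f x0 y0 / 2" .
  obtain R where R: "\<And>x y. R < x \<Longrightarrow> - d \<le> y \<Longrightarrow> y \<le> \<eta> x \<Longrightarrow> f x y \<le> f x0 y0 / 2"
    using inf[of "f x0 y0 / 2"] pos by auto
  \<comment> \<open>Beyond \<open>R\<close> the values cannot compete, and \<open>max R x0\<close>
    keeps (x0, y0) inside; so a maximum over this compact piece is a maximum over the whole
    half-domain.\<close>
  define K where "K = Q \<inter> ({0..max R x0} \<times> {-d..H})"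
  have c\<eta>: "continuous_on UNIV (\<lambda>p::real \<times> real. \<eta> (fst p))"
    by (intro continuous_on_compose2[OF \<eta>] continuous_intros) auto
  have "closed Q" unfolding Q_def
    by (intro closed_Collect_conj closed_Collect_le continuous_intros c\<eta>)
  then have "compact K" unfolding K_def
    by (intro closed_Int_compact compact_Times compact_Icc)
  moreover have "(x0, y0) \<in> K" using x0 y0 H[of x0] by (auto simp: K_def Q_def)
  moreover have "continuous_on K (\<lambda>p. h (fst p) (snd p))" unfolding h_def
    by (intro continuous_intros continuous_on_subset[OF cont]) (auto simp: K_def Q_def)
  ultimately obtain p where p: "p \<in> K" "\<And>q. q \<in> K \<Longrightarrow> h (fst q) (snd q) \<le> h (fst p) (snd p)"
    using continuous_attains_sup[of K "\<lambda>p. h (fst p) (snd p)"] by blast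
  obtain x y where xy: "p = (x, y)" by (cases p)
  have hp: "h x0 y0 \<le> h x y" using p(2)[OF \<open>(x0, y0) \<in> K\<close>] xy by simp
  have Qxy: "0 \<le> x" "- d \<le> y" "y \<le> \<eta> x" using p(1) xy by (auto simp: K_def Q_def)
  have mx: "h x' y' \<le> h x y" if "G x' y'" for x' y'
  proof (cases "x' \<le> max R x0")
    case True
    then have "(x', y') \<in> K" using that H[of x'] by (auto simp: K_def Q_def G_def)
    then show ?thesis using p(2) xy by force
  next
    case False
    then have "f x' y' \<le> f x0 y0 / 2" using R that by (auto simp: G_def)
    then show ?thesis using hf[of y' x'] that h0 hp by (auto simp: G_def)
  qed
  have fpos: "f x y > 0" using hf[OF Qxy(3)] hp h0 pos by linarith
  then have Gxy: "G x y" using bdry[OF Qxy] Qxy unfolding G_def by force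
  have ox: "open {t. G t y}" unfolding G_def
    by (intro open_Collect_conj open_Collect_less continuous_intros \<eta>)
  have oy: "open {s. G x s}" unfolding G_def
    by (intro open_Collect_conj open_Collect_less continuous_intros)
  have dhx: "((\<lambda>t. h t y) has_real_derivative fx t y) (at t)" if "G t y" for t
    unfolding h_def using DERIV_add[OF dx[OF that] DERIV_const] by simp
  have dexp: "((\<lambda>s. \<epsilon> * exp (l * s)) has_real_derivative \<epsilon> * (l * exp (l * s))) (at s)" for s
    by (auto intro!: derivative_eq_intros)
  have dhy: "((\<lambda>s. h x s) has_real_derivative fy x s + \<epsilon> * (l * exp (l * s))) (at s)" if "G x s" for s
    unfolding h_def right_diff_distrib
    using DERIV_add[OF dy[OF that] DERIV_diff[OF dexp DERIV_const]] by simp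
  have 1: "fx x y = 0" "fxx x y \<le> 0"
  proof -
    have "\<And>t. t \<in> {t. G t y} \<Longrightarrow> ((\<lambda>t. h t y) has_real_derivative fx t y) (at t)"
      "\<And>t. t \<in> {t. G t y} \<Longrightarrow> h t y \<le> h x y" using dhx mx by simp_all
    note deriv_tests_at_max[OF ox _ this(1) dxx[OF Gxy] this(2)]
    then show "fx x y = 0" "fxx x y \<le> 0" using Gxy by simp_all
  qed
  define E where "E = \<epsilon> * l * exp (l * y)"
  have E: "E > 0" using \<epsilon> l by (simp add: E_def)
  have "((\<lambda>s. fy x s + \<epsilon> * (l * exp (l * s))) has_real_derivative fyy x y + l * E) (at y)"
    using DERIV_add[OF dyy[OF Gxy] DERIV_cmult[OF dexp, of l]] by (simp add: E_def algebra_simps)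
  moreover have "\<And>s. s \<in> {s. G x s} \<Longrightarrow>
        ((\<lambda>s. h x s) has_real_derivative fy x s + \<epsilon> * (l * exp (l * s))) (at s)"
      "\<And>s. s \<in> {s. G x s} \<Longrightarrow> h x s \<le> h x y" using dhy mx by simp_all
  ultimately have "fy x y + \<epsilon> * (l * exp (l * y)) = 0" and 2: "fyy x y + l * E \<le> 0"
    using deriv_tests_at_max[OF oy, of y "\<lambda>s. h x s" "\<lambda>s. fy x s + \<epsilon> * (l * exp (l * s))" "fyy x y + l * E"]
      Gxy by simp_all
  then have 3: "fy x y + E = 0" by (simp add: E_def)
  have "fy x y = - E" "fyy x y \<le> - l * E" using 2 3 by simp_all
  then have "fxx x y + fyy x y + b x y * fx x y + a x y * fy x y \<le> - (l + a x y) * E"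
    using 1 by (simp add: algebra_simps)
  also have "\<dots> < 0" using l(2)[OF Gxy] E by (simp add: mult_less_0_iff)
  finally show False using op[OF Gxy fpos] by simp
qed

text \<open>Continuity of one partial derivative in both variables, together with existence of the
  other, already gives total differentiability; the chain rule does the rest.\<close>

lemma has_real_derivative_along_graph:
  fixes f fx fy :: "real \<Rightarrow> real \<Rightarrow> real"
  assumes "open S" "(x, c x) \<in> S"
    and dx: "\<And>x y. (x, y) \<in> S \<Longrightarrow> ((\<lambda>t. f t y) has_real_derivative fx x y) (at x)"
    and dy: "\<And>x y. (x, y) \<in> S \<Longrightarrow> ((\<lambda>s. f x s) has_real_derivative fy x y) (at y)"
    and cont: "continuous_on S (\<lambda>p. fy (fst p) (snd p))"
    and c: "(c has_real_derivative c') (at x)"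
  shows "((\<lambda>t. f t (c t)) has_real_derivative fx x (c x) + c' * fy x (c x)) (at x)"
proof -
  obtain e where e: "e > 0" "ball (x, c x) e \<subseteq> S" using assms(1,2) openE by blast
  define X where "X = ball x (e / 2)"
  define Y where "Y = ball (c x) (e / 2)"
  have XY: "X \<times> Y \<subseteq> S"
  proof
    fix p assume "p \<in> X \<times> Y"
    then have "dist x (fst p) < e / 2" "dist (c x) (snd p) < e / 2" by (auto simp: X_def Y_def)
    then have "dist (x, c x) p < e"
      using sqrt_sum_squares_le_sum_abs[of "dist x (fst p)" "dist (c x) (snd p)"]
      by (auto simp: dist_prod_def)
    then show "p \<in> S" using e(2) by auto
  qed
  have in_XY: "x \<in> X" "c x \<in> Y" using e(1) by (auto simp: X_def Y_def)
  have "((\<lambda>(x, y). f x y) has_derivative (\<lambda>(tx, ty). fx x (c x) * tx + blinfun_scaleR_left (fy x (c x)) ty))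
     (at (x, c x) within X \<times> Y)"
  proof (rule has_derivative_partialsI[where fy = "\<lambda>x y. blinfun_scaleR_left (fy x y)"])
    show "((\<lambda>t. f t (c x)) has_derivative (*) (fx x (c x))) (at x within X)"
      using dx[OF assms(2)] by (auto simp: has_field_derivative_def intro: has_derivative_at_withinI)
  next
    fix x' y' assume "x' \<in> X" "y' \<in> Y"
    then have "(f x' has_real_derivative fy x' y') (at y')" using dy XY by auto
    then show "(f x' has_derivative blinfun_apply (blinfun_scaleR_left (fy x' y'))) (at y' within Y)"
      by (auto simp: has_field_derivative_def mult.commute[of _ "fy x' y'"] intro: has_derivative_at_withinI)
  next
    have "continuous_on (X \<times> Y) (\<lambda>p. blinfun_scaleR_left (fy (fst p) (snd p)))"
      by (intro bounded_linear.continuous_on[OF bounded_linear_blinfun_scaleR_left]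
          continuous_on_subset[OF cont XY])
    then show "continuous (at (x, c x) within X \<times> Y) (\<lambda>(x, y). blinfun_scaleR_left (fy x y))"
      using in_XY unfolding continuous_on_eq_continuous_within case_prod_beta by blast
  qed (use in_XY in \<open>auto simp: Y_def\<close>)
  moreover have "open (X \<times> Y)" by (auto simp: X_def Y_def intro: open_Times)
  ultimately have F: "((\<lambda>(x, y). f x y) has_derivative (\<lambda>(tx, ty). fx x (c x) * tx + fy x (c x) * ty)) (at (x, c x))"
    using in_XY by (simp add: at_within_open[of "(x, c x)" "X \<times> Y"] mult.commute[of "fy x (c x)"] case_prod_beta)
  have "((\<lambda>t. (t, c t)) has_derivative (\<lambda>h. (h, c' * h))) (at x)"
    using c by (auto simp: has_field_derivative_def intro!: derivative_intros)
  from has_derivative_compose[OF this F] show ?thesis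
    by (auto simp: has_field_derivative_def algebra_simps elim!: has_derivative_eq_rhs)
qed

text \<open>Lowering the graph by a small \<delta> puts it into the open set, where the chain rule
  applies. The mean value inequality then yields an estimate uniform in \<delta>, which survives
  \<delta> tending to 0. On the graph itself \<open>fx\<close> and \<open>fy\<close> are only
  continuous extensions.\<close>

lemma has_real_derivative_along_upper_graph:
  fixes f fx fy :: "real \<Rightarrow> real \<Rightarrow> real" and \<eta> \<eta>' :: "real \<Rightarrow> real"
  assumes "open S"
    and sub: "\<And>x y. - d < y \<Longrightarrow> y < \<eta> x \<Longrightarrow> (x, y) \<in> S"
    and cl: "\<And>x y. - d < y \<Longrightarrow> y \<le> \<eta> x \<Longrightarrow> (x, y) \<in> closure S"
    and pos: "\<And>x. - d < \<eta> x"
    and \<eta>: "\<And>x. (\<eta> has_real_derivative \<eta>' x) (at x)" and \<eta>': "continuous_on UNIV \<eta>'"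
    and dx: "\<And>x y. (x, y) \<in> S \<Longrightarrow> ((\<lambda>t. f t y) has_real_derivative fx x y) (at x)"
    and dy: "\<And>x y. (x, y) \<in> S \<Longrightarrow> ((\<lambda>s. f x s) has_real_derivative fy x y) (at y)"
    and cont: "continuous_on (closure S) (\<lambda>p. f (fst p) (snd p))"
      "continuous_on (closure S) (\<lambda>p. fx (fst p) (snd p))"
      "continuous_on (closure S) (\<lambda>p. fy (fst p) (snd p))"
  shows "((\<lambda>t. f t (\<eta> t)) has_real_derivative fx x (\<eta> x) + \<eta>' x * fy x (\<eta> x)) (at x)"
proof -
  have c\<eta>: "continuous_on A \<eta>" for A
    using DERIV_continuous_on[of A \<eta> \<eta>'] \<eta> has_field_derivative_at_within by blast
  \<comment> \<open>In the coordinates (x, \<delta>), with \<delta> the depth below the graph,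
    \<open>H\<close> is the derivative along the lowered graph and \<open>B\<close> is the set of
    admissible pairs.\<close>
  define H where "H p = fx (fst p) (\<eta> (fst p) - snd p) + \<eta>' (fst p) * fy (fst p) (\<eta> (fst p) - snd p)"
    for p :: "real \<times> real"
  define B where "B = {p. 0 \<le> snd p \<and> - d < \<eta> (fst p) - snd p}"
  have cB: "continuous_on B (\<lambda>p. g (fst p) (\<eta> (fst p) - snd p))"
    if "continuous_on (closure S) (\<lambda>p. g (fst p) (snd p))" for g :: "real \<Rightarrow> real \<Rightarrow> real"
  proof -
    have "continuous_on B (\<lambda>p. (fst p, \<eta> (fst p) - snd p))"
      by (intro continuous_intros continuous_on_compose2[OF c\<eta>[of UNIV]]) auto
    moreover have "(\<lambda>p. (fst p, \<eta> (fst p) - snd p)) ` B \<subseteq> closure S" using cl by (auto simp: B_def)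
    ultimately show ?thesis using continuous_on_compose2[OF that] by fastforce
  qed
  have "continuous_on B H" unfolding H_def
    by (intro continuous_intros cB cont continuous_on_compose2[OF \<eta>']) auto
  then have Hc: "(H \<longlongrightarrow> H (x, 0)) (at (x, 0) within B)"
    using pos[of x] by (auto simp: continuous_on_def B_def)
  have oB: "open {p. - d < \<eta> (fst p) - snd p}"
    by (intro open_Collect_less continuous_intros continuous_on_compose2[OF c\<eta>[of UNIV]]) auto
  have main: "\<exists>r>0. \<forall>t. dist t x < r \<longrightarrow> \<bar>f t (\<eta> t) - f x (\<eta> x) - H (x, 0) * (t - x)\<bar> \<le> \<epsilon> * \<bar>t - x\<bar>"
    if \<epsilon>: "\<epsilon> > 0" for \<epsilon>
  proof -
    obtain r1 where r1: "r1 > 0" "\<And>p. p \<in> B \<Longrightarrow> p \<noteq> (x, 0) \<Longrightarrow> dist p (x, 0) < r1 \<Longrightarrow> \<bar>H p - H (x, 0)\<bar> < \<epsilon>"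
      using tendstoD[OF Hc \<epsilon>] by (auto simp: eventually_at dist_real_def)
    obtain r2 where r2: "r2 > 0" "ball (x, 0) r2 \<subseteq> {p. - d < \<eta> (fst p) - snd p}"
      using openE[OF oB, of "(x, 0)"] pos[of x] by auto
    define r where "r = min r1 r2 / 2"
    have r: "r > 0" using r1 r2 by (simp add: r_def)
    have dr: "dist (s, \<delta>) (x, 0) < r1" "dist (s, \<delta>) (x, 0) < r2"
      if "\<bar>s - x\<bar> < r" "\<bar>\<delta>\<bar> < r" for s \<delta>
      using that sqrt_sum_squares_le_sum_abs[of "s - x" \<delta>] by (auto simp: dist_prod_def dist_real_def r_def)
    have in_B: "(s, \<delta>) \<in> B" if "\<bar>s - x\<bar> < r" "0 \<le> \<delta>" "\<delta> < r" for s \<delta>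
    proof -
      have "(s, \<delta>) \<in> ball (x, 0) r2" using dr(2)[of s \<delta>] that by (simp add: dist_commute)
      then show ?thesis using r2(2) that by (auto simp: B_def)
    qed
    have shifted: "\<bar>f t (\<eta> t - \<delta>) - f x (\<eta> x - \<delta>) - H (x, 0) * (t - x)\<bar> \<le> \<epsilon> * \<bar>t - x\<bar>"
      if t: "\<bar>t - x\<bar> < r" and \<delta>: "0 < \<delta>" "\<delta> < r" for t \<delta>
    proof -
      have D: "((\<lambda>t. f t (\<eta> t - \<delta>) - H (x, 0) * t) has_real_derivative H (s, \<delta>) - H (x, 0)) (at s)"
        if "\<bar>s - x\<bar> < r" for s
      proof -
        have "(s, \<eta> s - \<delta>) \<in> S" using in_B[of s \<delta>] that \<delta> sub by (auto simp: B_def)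
        moreover have "continuous_on S (\<lambda>p. fy (fst p) (snd p))"
          using cont(3) closure_subset continuous_on_subset by blast
        moreover have "((\<lambda>t. \<eta> t - \<delta>) has_real_derivative \<eta>' s) (at s)"
          using DERIV_diff[OF \<eta>[of s] DERIV_const[of \<delta>]] by simp
        ultimately have "((\<lambda>t. f t (\<eta> t - \<delta>)) has_real_derivative H (s, \<delta>)) (at s)"
          using has_real_derivative_along_graph[OF \<open>open S\<close>, of s "\<lambda>t. \<eta> t - \<delta>" f fx fy "\<eta>' s"] dx dy
          by (auto simp: H_def)
        then show ?thesis by (auto intro!: derivative_eq_intros)
      qed
      have Hb: "\<bar>H (s, \<delta>) - H (x, 0)\<bar> \<le> \<epsilon>" if "\<bar>s - x\<bar> < r" for s
        using r1(2)[OF in_B[of s \<delta>]] dr[of s \<delta>] that \<delta> by force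
      have "norm ((f t (\<eta> t - \<delta>) - H (x, 0) * t) - (f x (\<eta> x - \<delta>) - H (x, 0) * x)) \<le> \<epsilon> * norm (t - x)"
        by (rule field_differentiable_bound[where S = "ball x r" and f' = "\<lambda>s. H (s, \<delta>) - H (x, 0)"])
          (use t r D Hb in \<open>auto simp: dist_real_def abs_minus_commute intro: has_field_derivative_at_within\<close>)
      then show ?thesis by (simp add: algebra_simps)
    qed
    have "\<bar>f t (\<eta> t) - f x (\<eta> x) - H (x, 0) * (t - x)\<bar> \<le> \<epsilon> * \<bar>t - x\<bar>" if t: "\<bar>t - x\<bar> < r" for t
    proof -
      have lim: "((\<lambda>\<delta>. f s (\<eta> s - \<delta>)) \<longlongrightarrow> f s (\<eta> s)) (at_right 0)" if "\<bar>s - x\<bar> < r" for s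
      proof -
        have "continuous_on {0..<r} (\<lambda>\<delta>. f s (\<eta> s - \<delta>))"
        proof -
          have "continuous_on {0..<r} (Pair s)" by (intro continuous_intros)
          moreover have "Pair s ` {0..<r} \<subseteq> B" using in_B that by auto
          ultimately show ?thesis using continuous_on_compose2[OF cB[OF cont(1)]] by fastforce
        qed
        then have "((\<lambda>\<delta>. f s (\<eta> s - \<delta>)) \<longlongrightarrow> f s (\<eta> s)) (at 0 within {0..<r})"
          unfolding continuous_on_def by (rule bspec[where x = 0, THEN rev_mp]) (use r in auto)
        moreover have "at 0 within {0..<r} = at_right 0"
          by (rule at_within_nhd[of _ "{-r<..<r}"]) (use r in auto)
        ultimately show ?thesis by simp
      qed
      have "((\<lambda>\<delta>. \<bar>f t (\<eta> t - \<delta>) - f x (\<eta> x - \<delta>) - H (x, 0) * (t - x)\<bar>) \<longlongrightarrow>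
          \<bar>f t (\<eta> t) - f x (\<eta> x) - H (x, 0) * (t - x)\<bar>) (at_right 0)"
        by (intro tendsto_intros lim) (use t r in auto)
      then show ?thesis
      proof (rule tendsto_upperbound)
        show "\<forall>\<^sub>F \<delta> in at_right 0. \<bar>f t (\<eta> t - \<delta>) - f x (\<eta> x - \<delta>) - H (x, 0) * (t - x)\<bar> \<le> \<epsilon> * \<bar>t - x\<bar>"
          using shifted[OF t] r by (auto simp: eventually_at_right_field)
      qed simp
    qed
    then show ?thesis using r by (auto simp: dist_real_def)
  qed
  have "((\<lambda>t. f t (\<eta> t)) has_derivative (*) (H (x, 0))) (at x)"
    unfolding has_derivative_within_alt
  proof (intro conjI allI impI)
    show "bounded_linear ((*) (H (x, 0)))" by (rule bounded_linear_mult_right)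
    fix e :: real assume "0 < e"
    then show "\<exists>r>0. \<forall>y\<in>UNIV. norm (y - x) < r \<longrightarrow>
        norm (f y (\<eta> y) - f x (\<eta> x) - H (x, 0) * (y - x)) \<le> e * norm (y - x)"
      using main[of e] by (auto simp: dist_real_def)
  qed
  then show ?thesis by (simp add: has_field_derivative_def H_def)
qed

section \<open>Identities for a solitary wave\<close>

lemma Ck_famD:
  assumes "Ck_fam k S f D"
  shows "D 0 0 = f"
    and "\<And>i j x y. i + j < k \<Longrightarrow> (x, y) \<in> S \<Longrightarrow> ((\<lambda>t. D i j t y) has_real_derivative D (Suc i) j x y) (at x)"
    and "\<And>i j x y. i + j < k \<Longrightarrow> (x, y) \<in> S \<Longrightarrow> ((\<lambda>s. D i j x s) has_real_derivative D i (Suc j) x y) (at y)"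
    and "\<And>i j. i + j \<le> k \<Longrightarrow> continuous_on (closure S) (\<lambda>p. D i j (fst p) (snd p))"
    and "\<And>i j. i + j \<le> k \<Longrightarrow> bounded ((\<lambda>p. D i j (fst p) (snd p)) ` closure S)"
  using assms unfolding Ck_fam_def by blast+

lemma DERIV_unique_on_open:
  fixes f h :: "real \<Rightarrow> real"
  assumes "open S" "x \<in> S" "\<And>y. y \<in> S \<Longrightarrow> f y = h y"
    and "(f has_real_derivative D) (at x)" "(h has_real_derivative E) (at x)"
  shows "D = E"
  using DERIV_unique[OF assms(4)] has_field_derivative_transform_within_open[OF assms(5,1,2)] assms(3) by metis

text \<open>Every wave comes with its own \<psi>, m and \<gamma>, so these are parameters.
  \<open>subcrit\<close> is the positivity of the limit of K at infinity.\<close>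

locale solitary =
  fixes g Patm :: real and w :: wave and \<psi> :: "real \<Rightarrow> real \<Rightarrow> real" and m :: real and \<gamma> :: "real \<Rightarrow> real"
  assumes g_pos: "g > 0"
    and wave: "solitary_wave g Patm w"
    and stream: "stream_vort w \<psi> m \<gamma>"
    and signs: "vort_signs m \<gamma>"
    and subcrit: "g - \<gamma> 0 * wuinf w 0 > 0"
begin

abbreviation u where "u \<equiv> wu w"
abbreviation v where "v \<equiv> wv w"
abbreviation \<eta> where "\<eta> \<equiv> weta w"
abbreviation d where "d \<equiv> wd w"
abbreviation \<Omega> where "\<Omega> \<equiv> Om w"
abbreviation Du where "Du \<equiv> cpd 3 (Om w) (wu w)"
abbreviation Dv where "Dv \<equiv> cpd 3 (Om w) (wv w)"
abbreviation DP where "DP \<equiv> cpd 3 (Om w) (wP w)"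
abbreviation \<eta>' where "\<eta>' \<equiv> deriv (weta w)"
abbreviation D\<gamma> where "D\<gamma> \<equiv> (SOME D. Ck_int 2 0 m \<gamma> D)"

lemmas wave_conds = wave[unfolded solitary_wave_def Let_def]
lemmas stream_conds = stream[unfolded stream_vort_def Let_def]

lemma d_pos: "d > 0"
  using wave_conds by (elim conjE)

lemma m_pos: "m > 0"
  using stream_conds by (elim conjE)

lemma eta_C4: "Ck_bdd_R 4 \<eta>"
  using wave_conds by (elim conjE)

lemma fam_u: "Ck_fam 3 \<Omega> u Du" and fam_v: "Ck_fam 3 \<Omega> v Dv" and fam_P: "Ck_fam 3 \<Omega> (wP w) DP"
proof -
  have "\<exists>D. Ck_fam 3 \<Omega> u D" "\<exists>D. Ck_fam 3 \<Omega> v D" "\<exists>D. Ck_fam 3 \<Omega> (wP w) D"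
    using wave_conds by blast+
  from this[THEN someI_ex] show "Ck_fam 3 \<Omega> u Du" "Ck_fam 3 \<Omega> v Dv" "Ck_fam 3 \<Omega> (wP w) DP"
    unfolding cpd_def .
qed

lemmas Du_00 = Ck_famD(1)[OF fam_u] and Dv_00 = Ck_famD(1)[OF fam_v] and DP_00 = Ck_famD(1)[OF fam_P]
lemmas Du_x = Ck_famD(2)[OF fam_u] and Dv_x = Ck_famD(2)[OF fam_v]
lemmas Du_y = Ck_famD(3)[OF fam_u] and Dv_y = Ck_famD(3)[OF fam_v]
lemmas Du_cont = Ck_famD(4)[OF fam_u] and Dv_cont = Ck_famD(4)[OF fam_v]
lemmas Du_bdd = Ck_famD(5)[OF fam_u]

lemma fam_int: "Ck_int 2 0 m \<gamma> D\<gamma>"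
proof -
  have "\<exists>D. Ck_int 2 0 m \<gamma> D"
    using stream_conds by (elim conjE)
  then show ?thesis by (rule someI_ex)
qed

lemma eta_deriv: "(\<eta> has_real_derivative \<eta>' x) (at x)"
  and eta_deriv2: "(\<eta>' has_real_derivative deriv \<eta>' x) (at x)"
proof -
  have *: "((deriv ^^ j) \<eta> has_real_derivative (deriv ^^ Suc j) \<eta> x) (at x)" if "j < 4" for j
    using eta_C4 that unfolding Ck_bdd_R_def by blast
  show "(\<eta> has_real_derivative \<eta>' x) (at x)" using *[of 0] by simp
  show "(\<eta>' has_real_derivative deriv \<eta>' x) (at x)" using *[of 1] by simp
qed

lemma cont_eta: "continuous_on A \<eta>"
  by (rule DERIV_continuous_on[OF has_field_derivative_at_within[OF eta_deriv]])

lemma cont_eta': "continuous_on A \<eta>'"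
  by (rule DERIV_continuous_on[OF has_field_derivative_at_within[OF eta_deriv2]])

lemma eta_bdd_above: "\<exists>H. \<forall>x. \<eta> x \<le> H"
proof -
  have "bounded (range ((deriv ^^ 0) \<eta>))" using eta_C4 unfolding Ck_bdd_R_def by blast
  then obtain B where "\<And>x. norm (\<eta> x) \<le> B" unfolding bounded_iff by auto
  then show ?thesis by (metis abs_le_D1 real_norm_def)
qed

lemma eta_lim: "(\<eta> \<longlongrightarrow> 0) at_infinity"
  using wave_conds by (elim conjE)

lemma eta_even: "\<eta> (- x) = \<eta> x"
  using wave_conds by blast

lemma psi_top: "\<psi> x (\<eta> x) = 0" and psi_bottom: "\<psi> x (- d) = m"
  using stream_conds by blast+

text \<open>Since \<eta> tends to 0 > -d, a column of nonpositive height would force \<eta> = -d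
  somewhere by the intermediate value theorem; there \<psi> would equal both 0 and m. Nonempty
  columns are what identifies the closure of the domain.\<close>

lemma eta_gt: "- d < \<eta> x"
proof (rule ccontr)
  assume "\<not> - d < \<eta> x"
  have "\<forall>\<^sub>F t in at_infinity. - d < \<eta> t"
    using order_tendstoD(1)[OF eta_lim, of "- d"] d_pos by simp
  then obtain b where b: "\<And>t. b \<le> norm t \<Longrightarrow> - d < \<eta> t" by (auto simp: eventually_at_infinity)
  define z where "z = max x b"
  have z: "x \<le> z" "- d < \<eta> z"
    by (auto simp: z_def intro!: b)
  then obtain y where "\<eta> y = - d"
    using IVT'[of \<eta> x "- d" z] \<open>\<not> - d < \<eta> x\<close> cont_eta by auto
  then show False using psi_top[of y] psi_bottom[of y] m_pos by simp
qed

lemma open_Om: "open \<Omega>"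
  unfolding Om_def
  by (intro open_Collect_conj open_Collect_less continuous_intros continuous_on_compose2[OF cont_eta[of UNIV]]) auto

lemma in_Om: "(x, y) \<in> \<Omega> \<longleftrightarrow> - d < y \<and> y < \<eta> x"
  by (simp add: Om_def)

lemma closure_Om: "(x, y) \<in> closure \<Omega> \<longleftrightarrow> - d \<le> y \<and> y \<le> \<eta> x"
proof
  have "closed {p. - d \<le> snd p \<and> snd p \<le> \<eta> (fst p)}"
    by (intro closed_Collect_conj closed_Collect_le continuous_intros continuous_on_compose2[OF cont_eta[of UNIV]]) auto
  then have "closure \<Omega> \<subseteq> {p. - d \<le> snd p \<and> snd p \<le> \<eta> (fst p)}"
    by (rule closure_minimal[rotated]) (auto simp: Om_def)
  then show "(x, y) \<in> closure \<Omega> \<Longrightarrow> - d \<le> y \<and> y \<le> \<eta> x" by auto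
next
  assume "- d \<le> y \<and> y \<le> \<eta> x"
  then have "y \<in> closure {- d<..<\<eta> x}" using eta_gt[of x] by simp
  then have "(x, y) \<in> closure ({x} \<times> {- d<..<\<eta> x})" by (simp add: closure_Times)
  moreover have "{x} \<times> {- d<..<\<eta> x} \<subseteq> \<Omega>" by (auto simp: Om_def)
  ultimately show "(x, y) \<in> closure \<Omega>" using closure_mono by blast
qed

lemma top_in_closure: "(x, \<eta> x) \<in> closure \<Omega>" and bottom_in_closure: "(x, - d) \<in> closure \<Omega>"
  using eta_gt[of x] by (simp_all add: closure_Om)

lemma Om_subset_closure: "(x, y) \<in> \<Omega> \<Longrightarrow> (x, y) \<in> closure \<Omega>"
  using closure_subset by blast

text \<open>The source of all identities obtained by differentiating along the free surface.\<close>

lemma trace_deriv: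
  assumes "Ck_fam k \<Omega> f D" "i + j < k"
  shows "((\<lambda>t. D i j t (\<eta> t)) has_real_derivative D (Suc i) j x (\<eta> x) + \<eta>' x * D i (Suc j) x (\<eta> x)) (at x)"
  by (rule has_real_derivative_along_upper_graph[OF open_Om, of d])
    (use assms(2) eta_gt eta_deriv cont_eta' in
      \<open>auto simp: in_Om closure_Om intro: Ck_famD(2-4)[OF assms(1)]\<close>)

lemmas Du_trace_deriv = trace_deriv[OF fam_u] and Dv_trace_deriv = trace_deriv[OF fam_v]

lemma column_cont:
  assumes "continuous_on (closure \<Omega>) (\<lambda>p. f (fst p) (snd p))"
  shows "continuous_on {- d..\<eta> x} (\<lambda>y. f x y)"
proof -
  have "continuous_on {- d..\<eta> x} (Pair x)" by (intro continuous_intros)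
  moreover have "Pair x ` {- d..\<eta> x} \<subseteq> closure \<Omega>" by (auto simp: closure_Om)
  ultimately show ?thesis using continuous_on_compose2[OF assms] by fastforce
qed

lemma trace_cont:
  assumes "continuous_on (closure \<Omega>) (\<lambda>p. f (fst p) (snd p))"
  shows "continuous_on A (\<lambda>x. f x (\<eta> x))"
proof -
  have "continuous_on A (\<lambda>x. (x, \<eta> x))" by (intro continuous_intros cont_eta)
  moreover have "(\<lambda>x. (x, \<eta> x)) ` A \<subseteq> closure \<Omega>" using top_in_closure by auto
  ultimately show ?thesis using continuous_on_compose2[OF assms] by fastforce
qed

lemma u_bound: "\<exists>c<0. \<forall>x y. (x, y) \<in> closure \<Omega> \<longrightarrow> u x y \<le> c"
proof -
  obtain c where c: "c < 0" "\<And>p. p \<in> \<Omega> \<Longrightarrow> u (fst p) (snd p) \<le> c" using wave_conds by blast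
  have "u x y \<le> c" if "(x, y) \<in> closure \<Omega>" for x y
    using continuous_le_on_closure[OF Du_cont[of 0 0, unfolded Du_00] that, of c] c(2) by simp
  then show ?thesis using c(1) by blast
qed

lemma u_neg: "(x, y) \<in> closure \<Omega> \<Longrightarrow> u x y < 0"
  using u_bound by fastforce

lemma incompressible: "(x, y) \<in> closure \<Omega> \<Longrightarrow> Dv 0 1 x y = - Du 1 0 x y"
proof -
  assume "(x, y) \<in> closure \<Omega>"
  moreover have "continuous_on (closure \<Omega>) (\<lambda>p. Du 1 0 (fst p) (snd p) + Dv 0 1 (fst p) (snd p))"
    by (intro continuous_intros Du_cont Dv_cont) auto
  moreover have "Du 1 0 (fst p) (snd p) + Dv 0 1 (fst p) (snd p) = 0" if "p \<in> \<Omega>" for p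
    using wave_conds that by (cases p) auto
  ultimately show ?thesis
    using continuous_constant_on_closure[of \<Omega> "\<lambda>p. Du 1 0 (fst p) (snd p) + Dv 0 1 (fst p) (snd p)" 0 "(x, y)"]
    by auto
qed

lemma euler_closure:
  assumes "(x, y) \<in> closure \<Omega>"
  shows "u x y * Du 1 0 x y + v x y * Du 0 1 x y = - DP 1 0 x y"
    and "u x y * Dv 1 0 x y + v x y * Dv 0 1 x y = - DP 0 1 x y - g"
proof -
  note C = Du_cont[of 0 0, unfolded Du_00] Dv_cont[of 0 0, unfolded Dv_00] Du_cont Dv_cont Ck_famD(4)[OF fam_P]
  let ?F = "\<lambda>p. u (fst p) (snd p) * Du 1 0 (fst p) (snd p) + v (fst p) (snd p) * Du 0 1 (fst p) (snd p)
      + DP 1 0 (fst p) (snd p)"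
  let ?G = "\<lambda>p. u (fst p) (snd p) * Dv 1 0 (fst p) (snd p) + v (fst p) (snd p) * Dv 0 1 (fst p) (snd p)
      + DP 0 1 (fst p) (snd p)"
  have E: "u x y * Du 1 0 x y + v x y * Du 0 1 x y = - DP 1 0 x y \<and>
      u x y * Dv 1 0 x y + v x y * Dv 0 1 x y = - DP 0 1 x y - g" if "(x, y) \<in> \<Omega>" for x y
    using wave_conds that by blast
  have "continuous_on (closure \<Omega>) ?F" "continuous_on (closure \<Omega>) ?G"
    by (intro continuous_intros C; simp)+
  moreover have "?F p = 0 \<and> ?G p = - g" if "p \<in> \<Omega>" for p
    using E[of "fst p" "snd p"] that by simp
  ultimately have "?F (x, y) = 0" "?G (x, y) = - g"
    using continuous_constant_on_closure[OF _ _ assms, of ?F] continuous_constant_on_closure[OF _ _ assms, of ?G]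
    by blast+
  then show "u x y * Du 1 0 x y + v x y * Du 0 1 x y = - DP 1 0 x y"
    and "u x y * Dv 1 0 x y + v x y * Dv 0 1 x y = - DP 0 1 x y - g" by simp_all
qed

section \<open>Stream function, vorticity function and the elliptic equations they imply\<close>

lemma psi_y: "(x, y) \<in> \<Omega> \<Longrightarrow> ((\<lambda>s. \<psi> x s) has_real_derivative u x y) (at y)"
  and psi_x: "(x, y) \<in> \<Omega> \<Longrightarrow> ((\<lambda>t. \<psi> t y) has_real_derivative - v x y) (at x)"
  using stream_conds by blast+

lemma psi_cont: "continuous_on (closure \<Omega>) (\<lambda>p. \<psi> (fst p) (snd p))"
  using stream_conds by (elim conjE)

text \<open>\<psi> decreases strictly from m to 0 in each column because its y-derivative u is
  negative. The sign conditions on \<gamma>, given on the open interval, thus apply at every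
  interior point.\<close>

lemma psi_range:
  assumes "(x, y) \<in> \<Omega>"
  shows "0 < \<psi> x y" "\<psi> x y < m"
proof -
  have y: "- d < y" "y < \<eta> x" using assms by (auto simp: in_Om)
  have dec: "\<psi> x b < \<psi> x a" if "- d \<le> a" "a < b" "b \<le> \<eta> x" for a b
  proof (rule DERIV_neg_imp_decreasing_open[OF that(2)])
    fix s assume "a < s" "s < b"
    then have "(x, s) \<in> \<Omega>" using that by (auto simp: in_Om)
    then show "\<exists>z. ((\<lambda>s. \<psi> x s) has_real_derivative z) (at s) \<and> z < 0"
      using psi_y u_neg Om_subset_closure by blast
  qed (rule continuous_on_subset[OF column_cont[OF psi_cont]], use that in auto)
  show "0 < \<psi> x y" using dec[of y "\<eta> x"] y psi_top by simp
  show "\<psi> x y < m" using dec[of "- d" y] y psi_bottom by simp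
qed

lemma psi_range_closure:
  assumes "(x, y) \<in> closure \<Omega>"
  shows "\<psi> x y \<in> {0..m}"
  using continuous_le_on_closure[OF psi_cont assms, of m]
    continuous_ge_on_closure[OF psi_cont assms, of 0] psi_range
  by (fastforce simp: less_imp_le)

lemma gamma_deriv: "s \<in> {0<..<m} \<Longrightarrow> (\<gamma> has_real_derivative D\<gamma> 1 s) (at s)"
  and gamma_deriv2: "s \<in> {0<..<m} \<Longrightarrow> (D\<gamma> 1 has_real_derivative D\<gamma> 2 s) (at s)"
  and gamma_cont: "continuous_on {0..m} \<gamma>"
proof -
  have D0: "D\<gamma> 0 = \<gamma>" and D: "\<And>j y. j < 2 \<Longrightarrow> y \<in> {0..m} \<Longrightarrow>
      (D\<gamma> j has_real_derivative D\<gamma> (Suc j) y) (at y within {0..m})"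
    and C: "\<And>j. j \<le> 2 \<Longrightarrow> continuous_on {0..m} (D\<gamma> j)"
    using fam_int unfolding Ck_int_def by blast+
  show "continuous_on {0..m} \<gamma>" using C[of 0] D0 by simp
  assume s: "s \<in> {0<..<m}"
  then have "at s within {0..m} = at s" by (auto intro: at_within_interior)
  then show "(\<gamma> has_real_derivative D\<gamma> 1 s) (at s)" "(D\<gamma> 1 has_real_derivative D\<gamma> 2 s) (at s)"
    using D[of 0 s] D[of 1 s] D0 s by (auto simp: numeral_2_eq_2)
qed

lemma gamma_signs:
  assumes s: "s \<in> {0<..<m}"
  shows "\<gamma> s \<le> 0" "D\<gamma> 1 s \<le> 0" "D\<gamma> 2 s \<le> 0"
proof -
  have 1: "deriv \<gamma> t = D\<gamma> 1 t" if "t \<in> {0<..<m}" for t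
    using gamma_deriv[OF that] by (rule DERIV_imp_deriv)
  have "(deriv \<gamma> has_real_derivative D\<gamma> 2 s) (at s)"
    by (rule has_field_derivative_transform_within_open[OF gamma_deriv2[OF s] _ s]) (use 1 in auto)
  then have "deriv (deriv \<gamma>) s = D\<gamma> 2 s" by (rule DERIV_imp_deriv)
  then show "\<gamma> s \<le> 0" "D\<gamma> 1 s \<le> 0" "D\<gamma> 2 s \<le> 0"
    using signs s 1 unfolding vort_signs_def by metis+
qed

lemma gamma0: "\<gamma> 0 \<le> 0"
proof -
  have "closure {0<..<m} = {0..m}" using m_pos by simp
  then show ?thesis
    using continuous_le_on_closure[of "{0<..<m}" \<gamma> 0 0] gamma_cont gamma_signs(1) m_pos by auto
qed

lemma vorticity: "(x, y) \<in> \<Omega> \<Longrightarrow> Dv 1 0 x y - Du 0 1 x y = \<gamma> (\<psi> x y)"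
  using stream_conds by blast

lemma vorticity_top: "Du 0 1 x (\<eta> x) = Dv 1 0 x (\<eta> x) - \<gamma> 0"
proof -
  let ?F = "\<lambda>p. Dv 1 0 (fst p) (snd p) - Du 0 1 (fst p) (snd p) - \<gamma> (\<psi> (fst p) (snd p))"
  have "continuous_on (closure \<Omega>) (\<lambda>p. \<gamma> (\<psi> (fst p) (snd p)))"
    by (rule continuous_on_compose2[OF gamma_cont psi_cont]) (use psi_range_closure in auto)
  then have "continuous_on (closure \<Omega>) ?F" by (intro continuous_intros Du_cont Dv_cont) auto
  moreover have "?F p = 0" if "p \<in> \<Omega>" for p using vorticity that by (cases p) auto
  ultimately have "?F (x, \<eta> x) = 0"
    using continuous_constant_on_closure[OF _ _ top_in_closure, of ?F] by blast
  then show ?thesis by (simp add: psi_top)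
qed

lemma open_row: "open {t. (t, y) \<in> \<Omega>}" and open_column: "open {s. (x, s) \<in> \<Omega>}"
  unfolding in_Om by (intro open_Collect_conj open_Collect_less continuous_intros cont_eta)+

lemma gamma_psi_y:
  assumes "(x, y) \<in> \<Omega>"
  shows "((\<lambda>s. \<gamma> (\<psi> x s)) has_real_derivative D\<gamma> 1 (\<psi> x y) * u x y) (at y)"
  by (rule DERIV_chain2[OF gamma_deriv psi_y[OF assms]]) (use psi_range[OF assms] in auto)

lemma gamma_psi_x:
  assumes "(x, y) \<in> \<Omega>"
  shows "((\<lambda>t. \<gamma> (\<psi> t y)) has_real_derivative D\<gamma> 1 (\<psi> x y) * - v x y) (at x)"
  by (rule DERIV_chain2[OF gamma_deriv psi_x[OF assms]]) (use psi_range[OF assms] in auto)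

text \<open>Incompressibility is differentiated in x and in y. Equality of mixed derivatives is
  built into \<open>Ck_fam\<close>, whose entry with indices 1 1 serves both orders.\<close>

lemma mixed_v:
  assumes "(x, y) \<in> \<Omega>"
  shows "Dv 1 1 x y = - Du 2 0 x y" "Dv 0 2 x y = - Du 1 1 x y"
proof -
  have i: "Dv 0 1 x y = - Du 1 0 x y" if "(x, y) \<in> \<Omega>" for x y
    using incompressible Om_subset_closure that by blast
  show "Dv 1 1 x y = - Du 2 0 x y"
    using DERIV_unique_on_open[OF open_row, of x y "\<lambda>t. Dv 0 1 t y" "\<lambda>t. - Du 1 0 t y"]
      Dv_x[of 0 1 x y] DERIV_minus[OF Du_x[of 1 0 x y]] assms i by (auto simp: numeral_2_eq_2)
  show "Dv 0 2 x y = - Du 1 1 x y"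
    using DERIV_unique_on_open[OF open_column, of y x "\<lambda>s. Dv 0 1 x s" "\<lambda>s. - Du 1 0 x s"]
      Dv_y[of 0 1 x y] DERIV_minus[OF Du_y[of 1 0 x y]] assms i by (auto simp: numeral_2_eq_2)
qed

lemma laplace_u:
  assumes "(x, y) \<in> \<Omega>"
  shows "Du 2 0 x y + Du 0 2 x y = - D\<gamma> 1 (\<psi> x y) * u x y"
proof -
  have "Dv 1 1 x y - Du 0 2 x y = D\<gamma> 1 (\<psi> x y) * u x y"
    using DERIV_unique_on_open[OF open_column, of y x "\<lambda>s. Dv 1 0 x s - Du 0 1 x s" "\<lambda>s. \<gamma> (\<psi> x s)"]
      DERIV_diff[OF Dv_y[of 1 0 x y] Du_y[of 0 1 x y]] gamma_psi_y assms vorticity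
    by (auto simp: numeral_2_eq_2)
  then show ?thesis using mixed_v(1)[OF assms] by simp
qed

text \<open>The x-derivative of the vorticity equation. Thus v solves the same linear equation as u,
  which is why the quotient v/u loses its zeroth-order term.\<close>

lemma laplace_v:
  assumes "(x, y) \<in> \<Omega>"
  shows "Dv 2 0 x y + Dv 0 2 x y = - D\<gamma> 1 (\<psi> x y) * v x y"
proof -
  have "Dv 2 0 x y - Du 1 1 x y = - D\<gamma> 1 (\<psi> x y) * v x y"
    using DERIV_unique_on_open[OF open_row, of x y "\<lambda>t. Dv 1 0 t y - Du 0 1 t y" "\<lambda>t. \<gamma> (\<psi> t y)"]
      DERIV_diff[OF Dv_x[of 1 0 x y] Du_x[of 0 1 x y]] gamma_psi_x assms vorticity
    by (auto simp: numeral_2_eq_2)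
  then show ?thesis using mixed_v(2)[OF assms] by simp
qed

lemma laplace_ux:
  assumes "(x, y) \<in> \<Omega>"
  shows "Du 3 0 x y + Du 1 2 x y = D\<gamma> 2 (\<psi> x y) * u x y * v x y - D\<gamma> 1 (\<psi> x y) * Du 1 0 x y"
proof -
  have "((\<lambda>t. D\<gamma> 1 (\<psi> t y)) has_real_derivative D\<gamma> 2 (\<psi> x y) * - v x y) (at x)"
    by (rule DERIV_chain2[OF gamma_deriv2 psi_x[OF assms]]) (use psi_range[OF assms] in auto)
  from DERIV_minus[OF DERIV_mult[OF this Du_x[of 0 0 x y]]] assms
  have 1: "((\<lambda>t. - (D\<gamma> 1 (\<psi> t y) * u t y)) has_real_derivative
     - (D\<gamma> 2 (\<psi> x y) * - v x y * u x y + Du 1 0 x y * D\<gamma> 1 (\<psi> x y))) (at x)"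
    by (simp add: Du_00)
  have "((\<lambda>t. Du 2 0 t y + Du 0 2 t y) has_real_derivative Du 3 0 x y + Du 1 2 x y) (at x)"
    using DERIV_add[OF Du_x[of 2 0 x y] Du_x[of 0 2 x y]] assms by (simp add: numeral_3_eq_3 numeral_2_eq_2)
  from DERIV_unique_on_open[OF open_row _ _ this 1] assms laplace_u
  show ?thesis by (simp add: algebra_simps)
qed

text \<open>In the interior the Laplacian is -\<gamma>'(\<psi>) u with \<gamma>' \<le> 0 and u < 0.
  The inequality passes to the closure by continuity, and it is at surface points that it bounds
  u_yy by -u_xx.\<close>

lemma superharmonic_u:
  assumes "(x, y) \<in> closure \<Omega>"
  shows "Du 2 0 x y + Du 0 2 x y \<le> 0"
proof -
  have "continuous_on (closure \<Omega>) (\<lambda>p. Du 2 0 (fst p) (snd p) + Du 0 2 (fst p) (snd p))"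
    by (intro continuous_intros Du_cont) auto
  moreover have "Du 2 0 x y + Du 0 2 x y \<le> 0" if "(x, y) \<in> \<Omega>" for x y
    using laplace_u[OF that] gamma_signs(2)[of "\<psi> x y"] psi_range[OF that] u_neg[of x y] Om_subset_closure[OF that]
    by (simp add: mult_nonpos_nonpos)
  ultimately show ?thesis
    using continuous_le_on_closure[of \<Omega> "\<lambda>p. Du 2 0 (fst p) (snd p) + Du 0 2 (fst p) (snd p)" "(x, y)" 0] assms
    by auto
qed

section \<open>Conditions on the free surface and consequences of symmetry\<close>

lemma kinematic: "v x (\<eta> x) = \<eta>' x * u x (\<eta> x)"
  and pressure_top: "wP w x (\<eta> x) = Patm"
  and v_bottom: "v x (- d) = 0"
  using wave_conds by blast+

text \<open>The pressure is constant along the surface, so its tangential derivative vanishes.\<close>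
lemma dynamic:
  "((u x (\<eta> x))\<^sup>2 - (v x (\<eta> x))\<^sup>2) * Du 1 0 x (\<eta> x)
    = - v x (\<eta> x) * (g + u x (\<eta> x) * (Du 0 1 x (\<eta> x) + Dv 1 0 x (\<eta> x)))"
proof -
  have "((\<lambda>t. wP w t (\<eta> t)) has_real_derivative DP 1 0 x (\<eta> x) + \<eta>' x * DP 0 1 x (\<eta> x)) (at x)"
    using trace_deriv[OF fam_P, of 0 0 x] by (simp add: DP_00)
  then have "((\<lambda>t. Patm) has_real_derivative DP 1 0 x (\<eta> x) + \<eta>' x * DP 0 1 x (\<eta> x)) (at x)"
    by (simp add: pressure_top)
  then have P: "DP 1 0 x (\<eta> x) + \<eta>' x * DP 0 1 x (\<eta> x) = 0"
    by (rule DERIV_unique) (rule DERIV_const)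
  note e = euler_closure[OF top_in_closure, of x] and i = incompressible[OF top_in_closure, of x]
  have "DP 1 0 x (\<eta> x) = - (u x (\<eta> x) * Du 1 0 x (\<eta> x) + v x (\<eta> x) * Du 0 1 x (\<eta> x))"
    "DP 0 1 x (\<eta> x) = - (g + u x (\<eta> x) * Dv 1 0 x (\<eta> x) - v x (\<eta> x) * Du 1 0 x (\<eta> x))"
    using e unfolding i by linarith+
  with P have "u x (\<eta> x) * Du 1 0 x (\<eta> x) + v x (\<eta> x) * Du 0 1 x (\<eta> x)
      + \<eta>' x * (g + u x (\<eta> x) * Dv 1 0 x (\<eta> x) - v x (\<eta> x) * Du 1 0 x (\<eta> x)) = 0"
    by (simp only: mult_minus_right)
  then have "u x (\<eta> x) * (u x (\<eta> x) * Du 1 0 x (\<eta> x) + v x (\<eta> x) * Du 0 1 x (\<eta> x)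
      + \<eta>' x * (g + u x (\<eta> x) * Dv 1 0 x (\<eta> x) - v x (\<eta> x) * Du 1 0 x (\<eta> x))) = 0"
    by simp
  then have "u x (\<eta> x) * (u x (\<eta> x) * Du 1 0 x (\<eta> x) + v x (\<eta> x) * Du 0 1 x (\<eta> x))
      + v x (\<eta> x) * (g + u x (\<eta> x) * Dv 1 0 x (\<eta> x) - v x (\<eta> x) * Du 1 0 x (\<eta> x)) = 0"
    by (simp add: kinematic algebra_simps)
  then show ?thesis by (simp add: algebra_simps power2_eq_square)
qed

lemma symmetry:
  assumes "(x, y) \<in> closure \<Omega>"
  shows "u (- x) y = u x y" "v (- x) y = - v x y"
  using wave_conds assms by blast+

lemma v_axis: "- d \<le> y \<Longrightarrow> y \<le> \<eta> 0 \<Longrightarrow> v 0 y = 0"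
  using symmetry(2)[of 0 y] by (simp add: closure_Om)

text \<open>By oddness v vanishes along the axis, hence so does v_y = - u_x.\<close>

lemma ux_axis:
  assumes "- d \<le> y" "y \<le> \<eta> 0"
  shows "Du 1 0 0 y = 0"
proof -
  have 0: "Dv 0 1 0 y = 0" if "(0, y) \<in> \<Omega>" for y
    using DERIV_unique_on_open[OF open_column, of y 0 "\<lambda>s. v 0 s" "\<lambda>s. 0"] that v_axis
      Dv_y[of 0 0 0 y] by (simp add: Dv_00 in_Om)
  have "y \<in> closure {- d<..<\<eta> 0}" using assms eta_gt[of 0] by simp
  moreover have "continuous_on (closure {- d<..<\<eta> 0}) (\<lambda>y. Du 1 0 0 y)"
    using column_cont[OF Du_cont[of 1 0], of 0] eta_gt[of 0] by simp
  moreover have "Du 1 0 0 y = 0" if "y \<in> {- d<..<\<eta> 0}" for y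
    using 0[of y] incompressible[OF Om_subset_closure[of 0 y]] that by (simp add: in_Om)
  ultimately show ?thesis using continuous_constant_on_closure by blast
qed

lemma uxy_crest: "Du 1 1 0 (\<eta> 0) = 0"
proof -
  have "Du 1 1 0 y = 0" if "y \<in> {- d<..<\<eta> 0}" for y
    using DERIV_unique_on_open[OF open_column, of y 0 "\<lambda>s. Du 1 0 0 s" "\<lambda>s. 0"] that ux_axis
      Du_y[of 1 0 0 y] by (simp add: in_Om)
  moreover have "\<eta> 0 \<in> closure {- d<..<\<eta> 0}" using eta_gt[of 0] by simp
  moreover have "continuous_on (closure {- d<..<\<eta> 0}) (\<lambda>y. Du 1 1 0 y)"
    using column_cont[OF Du_cont[of 1 1], of 0] eta_gt[of 0] by simp
  ultimately show ?thesis using continuous_constant_on_closure by blast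
qed

end

section \<open>The surface functions K and N\<close>

text \<open>Far out the limit gives the bound L / 2; on the remaining compact interval the minimum
  is attained and positive.\<close>

lemma positive_bounded_away:
  fixes F :: "real \<Rightarrow> real"
  assumes c: "continuous_on {a..} F" and lim: "(F \<longlongrightarrow> L) at_top" and "L > 0"
    and pos: "\<And>x. a \<le> x \<Longrightarrow> 0 < F x"
  shows "\<exists>\<delta>>0. \<forall>x\<ge>a. \<delta> \<le> F x"
proof -
  have "\<forall>\<^sub>F x in at_top. L / 2 < F x" using lim \<open>L > 0\<close> by (intro order_tendstoD(1)) auto
  then obtain b where b: "\<And>x. b \<le> x \<Longrightarrow> L / 2 < F x" by (auto simp: eventually_at_top_linorder)
  have "continuous_on {a..max a b} F" using c by (rule continuous_on_subset) auto
  then obtain z where z: "z \<in> {a..max a b}" "\<And>x. x \<in> {a..max a b} \<Longrightarrow> F z \<le> F x"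
    using continuous_attains_inf[of "{a..max a b}" F] by (auto simp: Ball_def)
  show ?thesis
  proof (intro exI[of _ "min (F z) (L / 2)"] conjI allI impI)
    show "0 < min (F z) (L / 2)" using pos[of z] z(1) \<open>L > 0\<close> by auto
    fix x assume "a \<le> x"
    then show "min (F z) (L / 2) \<le> F x"
      using z(2)[of x] b[of x] by (cases "x \<le> max a b") (auto simp: min_le_iff_disj less_imp_le)
  qed
qed

context solitary
begin

definition K :: "real \<Rightarrow> real" where
  "K x = g + u x (\<eta> x) * (Du 0 1 x (\<eta> x) + Dv 1 0 x (\<eta> x))"

definition N :: "real \<Rightarrow> real" where
  "N x = (u x (\<eta> x))\<^sup>2 - (v x (\<eta> x))\<^sup>2"

text \<open>On the surface v_x and u_y differ by the constant \<gamma>(0). The form in u_y has a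
  derivative governed by the second derivatives of u; the form in v_x shows the limit at
  infinity.\<close>

lemma K_eq_uy: "K x = g + u x (\<eta> x) * (2 * Du 0 1 x (\<eta> x) + \<gamma> 0)"
  and K_eq_vx: "K x = g + u x (\<eta> x) * (2 * Dv 1 0 x (\<eta> x) - \<gamma> 0)"
  using vorticity_top[of x] by (simp_all add: K_def)

lemma N_ux: "N x * Du 1 0 x (\<eta> x) = - v x (\<eta> x) * K x"
  unfolding N_def K_def by (rule dynamic)

lemmas cont_traces = trace_cont[OF Du_cont] trace_cont[OF Dv_cont]
  trace_cont[OF Du_cont[of 0 0, unfolded Du_00]] trace_cont[OF Dv_cont[of 0 0, unfolded Dv_00]]

lemma K_cont: "continuous_on A K" and N_cont: "continuous_on A N"
  unfolding K_def N_def by (intro continuous_intros cont_traces; simp)+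

lemma u_trace_deriv: "((\<lambda>t. u t (\<eta> t)) has_real_derivative Du 1 0 x (\<eta> x) + \<eta>' x * Du 0 1 x (\<eta> x)) (at x)"
  using Du_trace_deriv[of 0 0 x] by (simp add: Du_00)

lemma v_trace_deriv: "((\<lambda>t. v t (\<eta> t)) has_real_derivative Dv 1 0 x (\<eta> x) - \<eta>' x * Du 1 0 x (\<eta> x)) (at x)"
  using Dv_trace_deriv[of 0 0 x] incompressible[OF top_in_closure, of x] by (simp add: Dv_00)

text \<open>Two evaluations of the derivative of v along the surface: as a trace, and by the product
  rule from v = \<eta>' u.\<close>

lemma curvature:
  "Dv 1 0 x (\<eta> x) - \<eta>' x * Du 1 0 x (\<eta> x)
    = deriv \<eta>' x * u x (\<eta> x) + \<eta>' x * (Du 1 0 x (\<eta> x) + \<eta>' x * Du 0 1 x (\<eta> x))"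
proof -
  have "((\<lambda>t. v t (\<eta> t)) has_real_derivative
      deriv \<eta>' x * u x (\<eta> x) + (Du 1 0 x (\<eta> x) + \<eta>' x * Du 0 1 x (\<eta> x)) * \<eta>' x) (at x)"
    unfolding kinematic by (rule DERIV_mult[OF eta_deriv2 u_trace_deriv])
  from DERIV_unique[OF v_trace_deriv this] show ?thesis by (simp add: mult.commute)
qed

lemma Dv_small:
  assumes "e > 0"
  shows "\<exists>R. \<forall>x y i j. R < x \<and> (x, y) \<in> closure \<Omega> \<and> i + j \<le> 2 \<longrightarrow> \<bar>Dv i j x y\<bar> < e"
proof -
  have "\<forall>e>0. \<exists>R. \<forall>x y i j. \<bar>x\<bar> > R \<and> (x, y) \<in> closure \<Omega> \<and> i + j \<le> 2 \<longrightarrow> \<bar>Dv i j x y\<bar> < e"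
    using wave_conds by (elim conjE)
  then obtain R where "\<forall>x y i j. \<bar>x\<bar> > R \<and> (x, y) \<in> closure \<Omega> \<and> i + j \<le> 2 \<longrightarrow> \<bar>Dv i j x y\<bar> < e"
    using assms by blast
  then show ?thesis by (intro exI[of _ R]) fastforce
qed

lemma Dv_trace_lim:
  assumes "i + j \<le> 2"
  shows "((\<lambda>x. Dv i j x (\<eta> x)) \<longlongrightarrow> 0) at_top"
proof (rule tendstoI)
  fix e :: real assume "e > 0"
  then obtain R where "\<And>x. R < x \<Longrightarrow> \<bar>Dv i j x (\<eta> x)\<bar> < e"
    using Dv_small[of e] top_in_closure assms by blast
  then show "\<forall>\<^sub>F x in at_top. dist (Dv i j x (\<eta> x)) 0 < e"
    by (auto intro: eventually_mono[OF eventually_gt_at_top[of R]])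
qed

lemma eta_lim_top: "(\<eta> \<longlongrightarrow> 0) at_top"
  using eta_lim at_top_le_at_infinity by (rule tendsto_mono[rotated])

text \<open>The asymptotics of u are given for y \<le> 0 only. For \<eta> \<ge> 0 the level y = 0
  lies in the closure, and the surface value differs from the value there by at most sup |u_y| times
  \<eta>, which tends to 0.\<close>

lemma u_trace_lim:
  assumes nonneg: "\<And>x. x \<ge> 0 \<Longrightarrow> \<eta> x \<ge> 0"
  shows "((\<lambda>x. u x (\<eta> x)) \<longlongrightarrow> wuinf w 0) at_top"
proof -
  obtain B where B: "\<And>x y. (x, y) \<in> closure \<Omega> \<Longrightarrow> \<bar>Du 0 1 x y\<bar> \<le> B"
    using Du_bdd[of 0 1] unfolding bounded_iff by fastforce
  have mvt: "\<bar>u x (\<eta> x) - u x 0\<bar> \<le> B * \<eta> x" if "x \<ge> 0" for x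
  proof (cases "\<eta> x = 0")
    case False
    then have pos: "0 < \<eta> x" using nonneg[OF that] by simp
    have D: "((\<lambda>s. u x s) has_real_derivative Du 0 1 x s) (at s)" if "0 < s" "s < \<eta> x" for s
      using Du_y[of 0 0 x s] that d_pos by (simp add: Du_00 in_Om)
    have "continuous_on {0..\<eta> x} (\<lambda>s. u x s)"
      by (rule continuous_on_subset[OF column_cont[OF Du_cont[of 0 0, unfolded Du_00]]]) (use d_pos in auto)
    then obtain l z where z: "0 < z" "z < \<eta> x" "((\<lambda>s. u x s) has_real_derivative l) (at z)"
      "u x (\<eta> x) - u x 0 = (\<eta> x - 0) * l"
      using MVT[OF pos, of "\<lambda>s. u x s"] D real_differentiable_def by blast
    then have "l = Du 0 1 x z" using D DERIV_unique by blast
    moreover have "\<bar>Du 0 1 x z\<bar> \<le> B" using B z d_pos by (auto simp: closure_Om)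
    ultimately show ?thesis using z(4) pos by (simp add: abs_mult)
  qed simp
  have "((\<lambda>x. u x (\<eta> x) - u x 0) \<longlongrightarrow> 0) at_top"
  proof (rule Lim_null_comparison)
    show "\<forall>\<^sub>F x in at_top. norm (u x (\<eta> x) - u x 0) \<le> B * \<eta> x"
      using mvt by (auto intro: eventually_mono[OF eventually_ge_at_top[of 0]])
    show "((\<lambda>x. B * \<eta> x) \<longlongrightarrow> 0) at_top" using tendsto_mult_right_zero[OF eta_lim_top] .
  qed
  moreover have "((\<lambda>x. u x 0) \<longlongrightarrow> wuinf w 0) at_top"
  proof (rule tendstoI)
    fix e :: real assume "e > 0"
    have "\<exists>D. Ck_int 3 (- d) 0 (wuinf w) D" using wave_conds by (elim conjE)
    then have "Ck_int 3 (- d) 0 (wuinf w) (cid 3 (- d) 0 (wuinf w))"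
      unfolding cid_def by (rule someI_ex)
    then have D0: "cid 3 (- d) 0 (wuinf w) 0 = wuinf w" by (simp add: Ck_int_def)
    have "\<forall>e>0. \<exists>R. \<forall>x y i j. \<bar>x\<bar> > R \<and> (x, y) \<in> closure \<Omega> \<and> y \<le> 0 \<and> i + j \<le> 2 \<longrightarrow>
        \<bar>Du i j x y - (if i = 0 then cid 3 (- d) 0 (wuinf w) j y else 0)\<bar> < e"
      using wave_conds by (elim conjE)
    then obtain R where R: "\<And>x y i j. \<bar>x\<bar> > R \<and> (x, y) \<in> closure \<Omega> \<and> y \<le> 0 \<and> i + j \<le> 2 \<Longrightarrow>
        \<bar>Du i j x y - (if i = 0 then cid 3 (- d) 0 (wuinf w) j y else 0)\<bar> < e"
      using \<open>e > 0\<close> by blast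
    have "\<bar>u x 0 - wuinf w 0\<bar> < e" if "x > max 0 R" for x
      using R[of x 0 0 0] that nonneg[of x] d_pos by (simp add: closure_Om Du_00 D0)
    then show "\<forall>\<^sub>F x in at_top. dist (u x 0) (wuinf w 0) < e"
      by (auto simp: dist_real_def intro: eventually_mono[OF eventually_gt_at_top[of "max 0 R"]])
  qed
  ultimately show ?thesis using tendsto_add by fastforce
qed

lemma uinf_neg:
  assumes nonneg: "\<And>x. x \<ge> 0 \<Longrightarrow> \<eta> x \<ge> 0"
  shows "wuinf w 0 < 0"
proof -
  obtain c where "c < 0" "\<And>x. u x (\<eta> x) \<le> c" using u_bound top_in_closure by blast
  then show ?thesis
    using tendsto_upperbound[OF u_trace_lim[OF nonneg], of c] by (auto simp: less_le_trans[of _ c])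
qed

text \<open>Turns pointwise positivity into a bound that survives uniform perturbations: N tends to
  the square of u_inf(0), which is nonzero by \<open>uinf_neg\<close>, and K tends to the quantity
  in \<open>subcrit\<close>.\<close>

lemma uniformly_positive:
  assumes nonneg: "\<And>x. x \<ge> 0 \<Longrightarrow> \<eta> x \<ge> 0"
    and K: "\<And>x. x \<ge> 0 \<Longrightarrow> K x > 0" and N: "\<And>x. x \<ge> 0 \<Longrightarrow> N x > 0"
  shows "\<exists>\<delta>>0. \<forall>x\<ge>0. \<delta> \<le> K x \<and> \<delta> \<le> N x"
proof -
  have v: "((\<lambda>x. v x (\<eta> x)) \<longlongrightarrow> 0) at_top" using Dv_trace_lim[of 0 0] by (simp add: Dv_00)
  have "(K \<longlongrightarrow> g + wuinf w 0 * (2 * 0 - \<gamma> 0)) at_top"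
    unfolding K_eq_vx[abs_def] by (intro tendsto_intros u_trace_lim[OF nonneg] Dv_trace_lim) auto
  then have "(K \<longlongrightarrow> g - \<gamma> 0 * wuinf w 0) at_top" by (simp add: mult.commute)
  then obtain \<delta>1 where 1: "\<delta>1 > 0" "\<And>x. x \<ge> 0 \<Longrightarrow> \<delta>1 \<le> K x"
    using positive_bounded_away[OF K_cont _ subcrit K] by blast
  have "(N \<longlongrightarrow> (wuinf w 0)\<^sup>2 - 0\<^sup>2) at_top"
    unfolding N_def[abs_def] by (intro tendsto_intros u_trace_lim[OF nonneg] v)
  moreover have "(wuinf w 0)\<^sup>2 - 0\<^sup>2 > 0" using uinf_neg[OF nonneg] by simp
  ultimately obtain \<delta>2 where 2: "\<delta>2 > 0" "\<And>x. x \<ge> 0 \<Longrightarrow> \<delta>2 \<le> N x"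
    using positive_bounded_away[OF N_cont _ _ N] by blast
  show ?thesis using 1 2 by (intro exI[of _ "min \<delta>1 \<delta>2"]) (auto simp: min_le_iff_disj)
qed

lemma eta'_crest: "\<eta>' 0 = 0"
  using kinematic[of 0] v_axis[of "\<eta> 0"] eta_gt[of 0] u_neg[OF top_in_closure, of 0] by simp

lemma eta'_eq: "\<eta>' x = v x (\<eta> x) / u x (\<eta> x)"
  using kinematic[of x] u_neg[OF top_in_closure, of x] by (simp add: field_simps)

text \<open>u times the derivative of the left-hand side along the surface is 2 (N u_x + v K), which
  vanishes by \<open>N_ux\<close>; the constant is read off at infinity.\<close>

lemma bernoulli:
  assumes nonneg: "\<And>x. x \<ge> 0 \<Longrightarrow> \<eta> x \<ge> 0"
  shows "(u x (\<eta> x))\<^sup>2 + (v x (\<eta> x))\<^sup>2 + 2 * g * \<eta> x = (wuinf w 0)\<^sup>2"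
proof -
  define E where "E t = (u t (\<eta> t))\<^sup>2 + (v t (\<eta> t))\<^sup>2 + 2 * g * \<eta> t" for t
  have "(E has_real_derivative 0) (at t)" for t
  proof -
    let ?U = "u t (\<eta> t)" and ?V = "v t (\<eta> t)" and ?Ux = "Du 1 0 t (\<eta> t)" and ?Uy = "Du 0 1 t (\<eta> t)"
      and ?Vx = "Dv 1 0 t (\<eta> t)"
    have D: "(E has_real_derivative 2 * ?U * (?Ux + \<eta>' t * ?Uy) + 2 * ?V * (?Vx - \<eta>' t * ?Ux) + 2 * g * \<eta>' t) (at t)"
      unfolding E_def[abs_def]
      by (auto intro!: derivative_eq_intros u_trace_deriv v_trace_deriv eta_deriv)
    have "?U * (2 * ?U * (?Ux + \<eta>' t * ?Uy) + 2 * ?V * (?Vx - \<eta>' t * ?Ux) + 2 * g * \<eta>' t)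
      = 2 * ?U * ?U * ?Ux + 2 * ?U * ?V * ?Uy + 2 * ?U * ?V * ?Vx - 2 * ?V * ?V * ?Ux + 2 * g * ?V"
      by (simp add: kinematic algebra_simps)
    also have "\<dots> = 2 * (N t * ?Ux + ?V * K t)"
      by (simp add: N_def K_def power2_eq_square algebra_simps)
    also have "\<dots> = 0" using N_ux[of t] by simp
    finally show ?thesis using D u_neg[OF top_in_closure, of t] by simp
  qed
  then have const: "E x = E t" for t by (intro DERIV_isconst_all allI)
  have v: "((\<lambda>x. v x (\<eta> x)) \<longlongrightarrow> 0) at_top" using Dv_trace_lim[of 0 0] by (simp add: Dv_00)
  have "(E \<longlongrightarrow> (wuinf w 0)\<^sup>2 + 0\<^sup>2 + 2 * g * 0) at_top"
    unfolding E_def[abs_def] by (intro tendsto_intros u_trace_lim[OF nonneg] v eta_lim_top)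
  moreover have "E = (\<lambda>t. E x)" by (rule ext) (rule const[symmetric])
  ultimately have "((\<lambda>t::real. E x) \<longlongrightarrow> (wuinf w 0)\<^sup>2) at_top" by simp
  then have "E x = (wuinf w 0)\<^sup>2" by (simp add: tendsto_const_iff)
  then show ?thesis by (simp add: E_def)
qed

text \<open>\<eta> is constant with limit 0; v is independent of x and odd in x, hence zero. The
  flat surface has v_x = 0 by \<open>curvature\<close>, and u there is constant and equals its
  limit, so K is exactly the quantity in \<open>subcrit\<close>.\<close>

lemma trivial_properties:
  assumes triv: "trivial_wave w"
  shows "\<eta> x = 0" and "(x, y) \<in> closure \<Omega> \<Longrightarrow> v x y = 0" and "K x > 0" and "N x > 0"
proof -
  have const: "\<eta> t = \<eta> 0" for t using triv unfolding trivial_wave_def by blast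
  then have "\<eta> = (\<lambda>t. \<eta> 0)" by auto
  then have "((\<lambda>t::real. \<eta> 0) \<longlongrightarrow> 0) at_top" using eta_lim_top by simp
  then have \<eta>0: "\<eta> t = 0" for t using const[of t] by (simp add: tendsto_const_iff)
  then show "\<eta> x = 0" .
  have v0: "v x y = 0" if "(x, y) \<in> closure \<Omega>" for x y
  proof -
    have "(- x, y) \<in> closure \<Omega>" using that by (simp add: closure_Om eta_even)
    then have "v x y = v (- x) y" using triv that unfolding trivial_wave_def by blast
    then show ?thesis using symmetry(2)[OF that] by simp
  qed
  show "(x, y) \<in> closure \<Omega> \<Longrightarrow> v x y = 0" by (rule v0)
  have vt: "v t (\<eta> t) = 0" for t using v0[OF top_in_closure] .
  show "N x > 0" using vt u_neg[OF top_in_closure, of x] by (simp add: N_def)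
  have "\<eta>' x = 0" using vt by (simp add: eta'_eq)
  moreover have "deriv \<eta>' x = 0"
  proof -
    have "\<eta>' = (\<lambda>t. 0)" using vt by (auto simp: eta'_eq)
    then show ?thesis by simp
  qed
  ultimately have vx: "Dv 1 0 x (\<eta> x) = 0" using curvature[of x] by simp
  have "u t (\<eta> t) = u x (\<eta> x)" for t
    using triv top_in_closure[of t] top_in_closure[of x] const unfolding trivial_wave_def by metis
  then have "(\<lambda>t. u t (\<eta> t)) = (\<lambda>t. u x (\<eta> x))" by (rule ext)
  moreover have "((\<lambda>t. u t (\<eta> t)) \<longlongrightarrow> wuinf w 0) at_top" by (rule u_trace_lim) (simp add: \<eta>0)
  ultimately have "((\<lambda>t::real. u x (\<eta> x)) \<longlongrightarrow> wuinf w 0) at_top" by simp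
  then have "u x (\<eta> x) = wuinf w 0" by (simp add: tendsto_const_iff)
  then show "K x > 0" using subcrit vx by (simp add: K_eq_vx mult.commute)
qed

end

section \<open>Monotone waves: signs of v and of the surface slope\<close>

locale monotone_solitary = solitary +
  assumes mono: "monotone_wave w"
begin

lemma v_pos: "x > 0 \<Longrightarrow> - d < y \<Longrightarrow> y \<le> \<eta> x \<Longrightarrow> v x y > 0"
  using mono unfolding monotone_wave_def by (cases "y = \<eta> x") (auto simp: in_Om)

lemma v_top_pos: "x > 0 \<Longrightarrow> v x (\<eta> x) > 0"
  using v_pos eta_gt by simp

lemma v_nonneg:
  assumes "(x, y) \<in> closure \<Omega>" "x \<ge> 0"
  shows "v x y \<ge> 0"
proof -
  consider "x = 0" | "y = - d" | "x > 0" "- d < y" using assms by (force simp: closure_Om)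
  then show ?thesis
    using v_axis v_bottom v_pos[of x y] assms by cases (auto simp: closure_Om less_imp_le)
qed

lemma eta'_neg: "x > 0 \<Longrightarrow> \<eta>' x < 0"
  using v_top_pos[of x] u_neg[OF top_in_closure, of x] by (simp add: eta'_eq divide_pos_neg)

lemma eta_decreasing: "0 \<le> x \<Longrightarrow> x < y \<Longrightarrow> \<eta> y < \<eta> x"
  by (rule DERIV_neg_imp_decreasing_open[of x y]) (use eta_deriv eta'_neg cont_eta in \<open>force+\<close>)

lemma eta_nonneg:
  assumes "0 \<le> x"
  shows "0 \<le> \<eta> x"
proof (rule tendsto_upperbound[OF eta_lim_top])
  show "\<forall>\<^sub>F t in at_top. \<eta> t \<le> \<eta> x"
    using eta_decreasing[OF assms] by (auto intro: eventually_mono[OF eventually_gt_at_top[of x]] less_imp_le)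
qed simp

end

section \<open>From nonstrict to strict inequalities for K and N\<close>

locale limit_solitary = monotone_solitary +
  assumes K_nonneg: "x \<ge> 0 \<Longrightarrow> K x \<ge> 0" and N_nonneg: "x \<ge> 0 \<Longrightarrow> N x \<ge> 0"
begin

lemma eta'_ge: "x \<ge> 0 \<Longrightarrow> - 1 \<le> \<eta>' x"
proof -
  assume "x \<ge> 0"
  then have "\<bar>v x (\<eta> x)\<bar> \<le> \<bar>u x (\<eta> x)\<bar>" using N_nonneg[of x] by (simp add: N_def abs_le_square_iff)
  then show ?thesis
    using u_neg[OF top_in_closure, of x] by (simp add: eta'_eq field_simps)
qed

text \<open>With slope -1 and zero curvature, \<open>curvature\<close> reduces to v_x - u_y = -2
  u_x, and the left-hand side is \<gamma>(0).\<close>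

lemma ux_steepest:
  assumes "x > 0" "N x = 0"
  shows "Du 1 0 x (\<eta> x) = - \<gamma> 0 / 2"
proof -
  have "\<bar>v x (\<eta> x)\<bar> = \<bar>u x (\<eta> x)\<bar>" using assms by (simp add: N_def flip: power2_eq_iff_nonneg[of "\<bar>v x (\<eta> x)\<bar>" "\<bar>u x (\<eta> x)\<bar>"])
  then have "v x (\<eta> x) = - u x (\<eta> x)"
    using v_top_pos[OF assms(1)] u_neg[OF top_in_closure, of x] by simp
  then have s: "\<eta>' x = - 1" using u_neg[OF top_in_closure, of x] by (simp add: eta'_eq)
  \<comment> \<open>The slope is extremal here, so the curvature vanishes.\<close>
  have "deriv \<eta>' x = 0"
    by (rule DERIV_local_min[OF eta_deriv2 assms(1)]) (use eta'_ge s in auto)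
  then show ?thesis using curvature[of x] s vorticity_top[of x] by simp
qed

text \<open>Where N > 0 the sign follows from \<open>N_ux\<close>. If N x = 0, let z be the first
  zero of N: it is positive because v = 0 at the crest, u_x \<le> 0 before z gives u_x \<le> 0 at z,
  and \<open>ux_steepest\<close> gives the same value of u_x at z and at x.\<close>

lemma ux_top_nonpos:
  assumes "x \<ge> 0"
  shows "Du 1 0 x (\<eta> x) \<le> 0"
proof -
  have off: "Du 1 0 t (\<eta> t) \<le> 0" if "t \<ge> 0" "N t > 0" for t
  proof -
    have "N t * Du 1 0 t (\<eta> t) \<le> 0"
      using N_ux[of t] K_nonneg[OF that(1)] v_nonneg[OF top_in_closure that(1)] by (simp add: mult_nonpos_nonneg)
    then show ?thesis using that(2) by (simp add: mult_le_0_iff)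
  qed
  show ?thesis
  proof (cases "N x > 0")
    case False
    define E where "E = {0..x} \<inter> N -` {0}"
    have Nx: "N x = 0" using False N_nonneg[OF assms] by simp
    have "closed E" unfolding E_def by (rule continuous_closed_preimage[OF N_cont]) auto
    then have "compact ({0..x} \<inter> E)" by (rule compact_Int_closed[OF compact_Icc])
    moreover have "{0..x} \<inter> E = E" by (auto simp: E_def)
    ultimately have "compact E" by simp
    moreover have "x \<in> E" using Nx assms by (auto simp: E_def)
    ultimately obtain z where z: "z \<in> E" "\<And>t. t \<in> E \<Longrightarrow> z \<le> t"
      using compact_attains_inf[of E] by blast
    have z0: "z > 0"
    proof -
      have "N 0 > 0" using v_axis[of "\<eta> 0"] eta_gt[of 0] u_neg[OF top_in_closure, of 0] by (simp add: N_def)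
      then show ?thesis using z(1) unfolding E_def by (cases "z = 0") auto
    qed
    have before: "Du 1 0 t (\<eta> t) \<le> 0" if "t \<in> {0..<z}" for t
    proof (rule off)
      show "N t > 0" using that z N_nonneg[of t] unfolding E_def by (cases "N t = 0") force+
    qed (use that in simp)
    have "closure {0..<z} = {0..z}" using z0 by simp
    then have "Du 1 0 z (\<eta> z) \<le> 0"
      using continuous_le_on_closure[of "{0..<z}" "\<lambda>t. Du 1 0 t (\<eta> t)" z 0] cont_traces(1)[of 1 0] before z0 by simp
    moreover have "Du 1 0 z (\<eta> z) = Du 1 0 x (\<eta> x)"
      using ux_steepest[of z] ux_steepest[of x] z0 z Nx by (auto simp: E_def)
    ultimately show ?thesis by simp
  qed (use off assms in blast)
qed

text \<open>v \<ge> 0 vanishes on the bottom, so v_y = - u_x is nonnegative there.\<close>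

lemma ux_bottom:
  assumes "x \<ge> 0"
  shows "Du 1 0 x (- d) \<le> 0"
proof -
  have "0 \<le> Dv 0 1 x (- d)"
  proof (rule right_deriv_at_min[OF eta_gt[of x], where f = "\<lambda>y. v x y"])
    show "continuous_on {- d..\<eta> x} (\<lambda>y. v x y)" "continuous_on {- d..\<eta> x} (\<lambda>y. Dv 0 1 x y)"
      using column_cont[OF Dv_cont[of 0 0]] column_cont[OF Dv_cont[of 0 1]] by (simp_all add: Dv_00)
    fix y assume "- d < y" "y < \<eta> x"
    then show "((\<lambda>y. v x y) has_real_derivative Dv 0 1 x y) (at y)" "v x (- d) \<le> v x y"
      using Dv_y[of 0 0 x y] v_nonneg[of x y] assms by (simp_all add: in_Om closure_Om Dv_00 v_bottom)
  qed
  then show ?thesis using incompressible[OF bottom_in_closure, of x] by simp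
qed

lemma ux_nonpos:
  assumes "(x, y) \<in> closure \<Omega>" "x \<ge> 0"
  shows "Du 1 0 x y \<le> 0"
proof -
  obtain H where H: "\<And>x. \<eta> x \<le> H" using eta_bdd_above by blast
  show ?thesis
  proof (rule weak_max_principle[OF cont_eta H, where d = d and f = "\<lambda>x y. Du 1 0 x y"
        and fx = "\<lambda>x y. Du 2 0 x y" and fy = "\<lambda>x y. Du 1 1 x y"
        and fxx = "\<lambda>x y. Du 3 0 x y" and fyy = "\<lambda>x y. Du 1 2 x y"
        and a = "\<lambda>x y. 0" and b = "\<lambda>x y. 0" and A = 0])
    show "continuous_on {p. 0 \<le> fst p \<and> - d \<le> snd p \<and> snd p \<le> \<eta> (fst p)} (\<lambda>p. Du 1 0 (fst p) (snd p))"
      by (rule continuous_on_subset[OF Du_cont]) (auto simp: closure_Om)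
  next
    fix x y assume "0 < x \<and> - d < y \<and> y < \<eta> x"
    then have Om: "(x, y) \<in> \<Omega>" and x: "x > 0" by (auto simp: in_Om)
    show "((\<lambda>t. Du 1 0 t y) has_real_derivative Du 2 0 x y) (at x)"
      "((\<lambda>s. Du 1 0 x s) has_real_derivative Du 1 1 x y) (at y)"
      "((\<lambda>t. Du 2 0 t y) has_real_derivative Du 3 0 x y) (at x)"
      "((\<lambda>s. Du 1 1 x s) has_real_derivative Du 1 2 x y) (at y)"
      using Du_x[of 1 0 x y] Du_y[of 1 0 x y] Du_x[of 2 0 x y] Du_y[of 1 1 x y] Om
      by (simp_all add: numeral_2_eq_2 numeral_3_eq_3)
    show "\<bar>0 :: real\<bar> \<le> 0" by simp
    assume pos: "0 < Du 1 0 x y"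
    have "\<psi> x y \<in> {0<..<m}" using psi_range[OF Om] by simp
    note s = gamma_signs[OF this]
    have "v x y \<ge> 0" "u x y \<le> 0"
      using v_nonneg u_neg[of x y] Om_subset_closure[OF Om] x by (auto simp: less_imp_le)
    then have "D\<gamma> 2 (\<psi> x y) * u x y * v x y \<ge> 0" using s(3) by (simp add: mult_nonpos_nonpos)
    moreover have "D\<gamma> 1 (\<psi> x y) * Du 1 0 x y \<le> 0" using s(2) pos by (simp add: mult_nonpos_nonneg)
    ultimately show "0 \<le> Du 3 0 x y + Du 1 2 x y + 0 * Du 2 0 x y + 0 * Du 1 1 x y"
      using laplace_ux[OF Om] by simp
  next
    fix x y :: real assume "0 \<le> x" "- d \<le> y" "y \<le> \<eta> x" "x = 0 \<or> y = - d \<or> y = \<eta> x"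
    then show "Du 1 0 x y \<le> 0" using ux_axis ux_bottom ux_top_nonpos by auto
  next
    fix e :: real assume "e > 0"
    then obtain R where R: "\<forall>x y i j. R < x \<and> (x, y) \<in> closure \<Omega> \<and> i + j \<le> 2 \<longrightarrow> \<bar>Dv i j x y\<bar> < e"
      using Dv_small by blast
    \<comment> \<open>Decay is read off from v_y = - u_x: the derivatives of v are small on the
      whole closure, whereas the asymptotics of u stop at y = 0.\<close>
    have "Du 1 0 x y \<le> e" if "R < x" "- d \<le> y" "y \<le> \<eta> x" for x y
      using R[rule_format, of x y 0 1] incompressible[of x y] that by (simp add: closure_Om)
    then show "\<exists>R. \<forall>x y. R < x \<and> - d \<le> y \<and> y \<le> \<eta> x \<longrightarrow> Du 1 0 x y \<le> e" by blast
  qed (use assms in \<open>auto simp: closure_Om\<close>)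
qed

lemma uy_sign:
  assumes "x \<ge> 0" "K x = 0"
  shows "Du 0 1 x (\<eta> x) > 0" "2 * Du 0 1 x (\<eta> x) + \<gamma> 0 > 0"
proof -
  have "u x (\<eta> x) * (2 * Du 0 1 x (\<eta> x) + \<gamma> 0) < 0" using assms K_eq_uy[of x] g_pos by simp
  then show *: "2 * Du 0 1 x (\<eta> x) + \<gamma> 0 > 0"
    using u_neg[OF top_in_closure, of x] by (simp add: mult_less_0_iff)
  show "Du 0 1 x (\<eta> x) > 0" using * gamma0 by simp
qed

lemma K_deriv: "(K has_real_derivative
    (Du 1 0 x (\<eta> x) + \<eta>' x * Du 0 1 x (\<eta> x)) * (2 * Du 0 1 x (\<eta> x) + \<gamma> 0)
    + 2 * u x (\<eta> x) * (Du 1 1 x (\<eta> x) + \<eta>' x * Du 0 2 x (\<eta> x))) (at x)"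
proof -
  have "((\<lambda>t. Du 0 1 t (\<eta> t)) has_real_derivative Du 1 1 x (\<eta> x) + \<eta>' x * Du 0 2 x (\<eta> x)) (at x)"
    using Du_trace_deriv[of 0 1 x] by (simp add: numeral_2_eq_2)
  then show ?thesis unfolding K_eq_uy[abs_def]
    by (auto intro!: derivative_eq_intros u_trace_deriv simp: algebra_simps)
qed

text \<open>At a zero, u_x is maximal both along the surface and in its column, which gives u_xx =
  -\<eta>' u_xy and u_xy \<ge> 0; since v > 0, also K = 0, a minimum of K. With u_yy \<le> 0 every
  term of K' is nonpositive and the one containing u_y is negative, against K' = 0.\<close>

lemma ux_top_neg:
  assumes x: "x > 0"
  shows "Du 1 0 x (\<eta> x) < 0"
proof (rule ccontr)
  assume "\<not> Du 1 0 x (\<eta> x) < 0"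
  then have ux: "Du 1 0 x (\<eta> x) = 0" using ux_top_nonpos[of x] x by simp
  have K0: "K x = 0" using N_ux[of x] ux v_top_pos[OF x] by simp
  have "Du 2 0 x (\<eta> x) + \<eta>' x * Du 1 1 x (\<eta> x) = 0"
  \<comment> \<open>The radius of the neighbourhood is x itself: points at distance less than x from
    x are positive, where u_x \<le> 0 is known.\<close>
  proof (rule DERIV_local_max[OF _ x])
    show "((\<lambda>t. Du 1 0 t (\<eta> t)) has_real_derivative Du 2 0 x (\<eta> x) + \<eta>' x * Du 1 1 x (\<eta> x)) (at x)"
      using Du_trace_deriv[of 1 0 x] by (simp add: numeral_2_eq_2)
  qed (use ux_top_nonpos ux in auto)
  then have uxx: "Du 2 0 x (\<eta> x) = - \<eta>' x * Du 1 1 x (\<eta> x)" by simp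
  have uxy: "0 \<le> Du 1 1 x (\<eta> x)"
  proof (rule left_deriv_at_max[OF eta_gt[of x], where f = "\<lambda>y. Du 1 0 x y" and f' = "\<lambda>y. Du 1 1 x y"])
    fix y assume "- d < y" "y < \<eta> x"
    then show "((\<lambda>y. Du 1 0 x y) has_real_derivative Du 1 1 x y) (at y)" "Du 1 0 x y \<le> Du 1 0 x (\<eta> x)"
      using Du_y[of 1 0 x y] ux_nonpos[of x y] x ux by (simp_all add: in_Om closure_Om)
  qed (auto intro!: column_cont Du_cont)
  have K': "(Du 1 0 x (\<eta> x) + \<eta>' x * Du 0 1 x (\<eta> x)) * (2 * Du 0 1 x (\<eta> x) + \<gamma> 0)
    + 2 * u x (\<eta> x) * (Du 1 1 x (\<eta> x) + \<eta>' x * Du 0 2 x (\<eta> x)) = 0"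
    by (rule DERIV_local_min[OF K_deriv x]) (use K_nonneg K0 in auto)
  have "\<eta>' x * Du 0 1 x (\<eta> x) * (2 * Du 0 1 x (\<eta> x) + \<gamma> 0) < 0"
    using uy_sign[of x] x K0 eta'_neg[OF x] by (simp add: mult_neg_pos)
  moreover have "u x (\<eta> x) * Du 1 1 x (\<eta> x) \<le> 0"
    using u_neg[OF top_in_closure, of x] uxy by (simp add: mult_nonpos_nonneg)
  moreover have "v x (\<eta> x) * Du 0 2 x (\<eta> x) \<le> 0"
  proof -
    \<comment> \<open>The Laplacian of u is nonpositive, so u_yy \<le> - u_xx = \<eta>'
      u_xy.\<close>
    have "Du 0 2 x (\<eta> x) \<le> \<eta>' x * Du 1 1 x (\<eta> x)"
      using superharmonic_u[OF top_in_closure, of x] uxx by simp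
    also have "\<dots> \<le> 0" using eta'_neg[OF x] uxy by (simp add: mult_nonpos_nonneg)
    finally show ?thesis using v_top_pos[OF x] by (simp add: mult_nonneg_nonpos)
  qed
  moreover have "\<eta>' x * Du 0 1 x (\<eta> x) * (2 * Du 0 1 x (\<eta> x) + \<gamma> 0)
    + 2 * (u x (\<eta> x) * Du 1 1 x (\<eta> x)) + 2 * (v x (\<eta> x) * Du 0 2 x (\<eta> x)) = 0"
    using K' ux by (simp add: kinematic algebra_simps)
  ultimately show False by linarith
qed

text \<open>Bernoulli's law and \<eta>(0) \<ge> 0 give u_inf(0) \<le> u < 0 at the crest, hence
  \<gamma>(0) u \<le> \<gamma>(0) u_inf(0) < g. Then K 0 = 0 makes v_x positive, and at the crest
  v_x = \<eta>'' u.\<close>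

lemma eta''_crest:
  assumes "K 0 = 0"
  shows "deriv \<eta>' 0 < 0"
proof -
  let ?U = "u 0 (\<eta> 0)"
  have U: "?U < 0" by (rule u_neg[OF top_in_closure])
  have "?U\<^sup>2 \<le> (wuinf w 0)\<^sup>2"
  proof -
    have "g * \<eta> 0 \<ge> 0" using eta_nonneg[of 0] g_pos by simp
    then show ?thesis using bernoulli[OF eta_nonneg, of 0] zero_le_power2[of "v 0 (\<eta> 0)"] by linarith
  qed
  then have "\<bar>?U\<bar> \<le> \<bar>wuinf w 0\<bar>" by (simp add: abs_le_square_iff)
  then have "wuinf w 0 \<le> ?U" using U uinf_neg[OF eta_nonneg] by simp
  then have "\<gamma> 0 * ?U \<le> \<gamma> 0 * wuinf w 0" using gamma0 by (rule mult_left_mono_neg)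
  then have "2 * (?U * Dv 1 0 0 (\<eta> 0)) < 0"
    using subcrit K_eq_vx[of 0] assms by (simp add: algebra_simps)
  then have "Dv 1 0 0 (\<eta> 0) > 0" using U by (simp add: mult_less_0_iff)
  then have "deriv \<eta>' 0 * ?U > 0" using curvature[of 0] by (simp add: eta'_crest)
  then show ?thesis using U by (simp add: zero_less_mult_iff)
qed

text \<open>The crest analogue of \<open>ux_top_neg\<close>, one order higher: u_x and K' vanish
  there, so u_xx takes the role of u_x, u_xxy that of u_xy, and K'' that of K'.\<close>

lemma K_crest: "K 0 > 0"
proof (rule ccontr)
  assume "\<not> K 0 > 0"
  then have K0: "K 0 = 0" using K_nonneg[of 0] by simp
  have v0: "v 0 (\<eta> 0) = 0" using v_axis[of "\<eta> 0"] eta_gt[of 0] by simp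
  have ux0: "Du 1 0 0 (\<eta> 0) = 0" using ux_axis eta_gt[of 0] by simp
  have U: "u 0 (\<eta> 0) < 0" by (rule u_neg[OF top_in_closure])
  have ux': "((\<lambda>t. Du 1 0 t (\<eta> t)) has_real_derivative Du 2 0 0 (\<eta> 0)) (at 0)"
    using Du_trace_deriv[of 1 0 0] by (simp add: numeral_2_eq_2 eta'_crest)
  obtain N' where N': "(N has_real_derivative N') (at 0)"
    using that[unfolded N_def[abs_def], OF DERIV_diff[OF DERIV_power[OF u_trace_deriv] DERIV_power[OF v_trace_deriv]]] .
  obtain V' where V': "((\<lambda>t. v t (\<eta> t)) has_real_derivative V') (at 0)" using v_trace_deriv by blast
  obtain K' where K': "(K has_real_derivative K') (at 0)" using K_deriv by blast
  \<comment> \<open>Both sides of \<open>N_ux\<close> are differentiated at 0. As v, u_x and K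
    vanish there, only N u_xx = 0 remains, and N 0 is nonzero.\<close>
  have "((\<lambda>t. - v t (\<eta> t) * K t) has_real_derivative - V' * K 0 + K' * - v 0 (\<eta> 0)) (at 0)"
    by (intro DERIV_mult DERIV_minus V' K')
  moreover have "((\<lambda>t. - v t (\<eta> t) * K t) has_real_derivative
      N' * Du 1 0 0 (\<eta> 0) + Du 2 0 0 (\<eta> 0) * N 0) (at 0)"
    unfolding N_ux[symmetric] by (intro DERIV_mult N' ux')
  ultimately have "Du 2 0 0 (\<eta> 0) * N 0 = 0"
    using DERIV_unique K0 v0 ux0 by fastforce
  then have uxx: "Du 2 0 0 (\<eta> 0) = 0" using v0 U by (simp add: N_def)
  \<comment> \<open>u_x is zero on the axis and nonpositive to its right. As u_xx = 0 at the crest,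
    u_xx on the axis is maximal there, which gives the sign of u_xxy.\<close>
  have uxx_axis: "Du 2 0 0 y \<le> 0" if y: "- d < y" "y < \<eta> 0" for y
  proof (rule ccontr)
    assume "\<not> Du 2 0 0 y \<le> 0"
    then have pos: "0 < Du 2 0 0 y" by simp
    have "((\<lambda>t. Du 1 0 t y) has_real_derivative Du 2 0 0 y) (at 0)"
      using Du_x[of 1 0 0 y] y by (simp add: in_Om numeral_2_eq_2)
    from DERIV_pos_inc_right[OF this pos]
    obtain e1 where e1: "e1 > 0" "\<And>h. h > 0 \<Longrightarrow> h < e1 \<Longrightarrow> Du 1 0 0 y < Du 1 0 (0 + h) y"
      by blast
    obtain e2 where e2: "e2 > 0" "ball 0 e2 \<subseteq> {t. (t, y) \<in> \<Omega>}"
    proof -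
      have "0 \<in> {t. (t, y) \<in> \<Omega>}" using y by (simp add: in_Om)
      with open_row show ?thesis by (rule openE) (rule that)
    qed
    define h where "h = min e1 e2 / 2"
    have h: "0 < h" "h < e1" "h < e2" using e1(1) e2(1) by (auto simp: h_def)
    have "h \<in> ball 0 e2" using h by simp
    then have "(h, y) \<in> closure \<Omega>" using e2(2) Om_subset_closure by blast
    then show False using e1(2)[of h] h ux_nonpos[of h y] ux_axis[of y] y by simp
  qed
  have uxxy: "0 \<le> Du 2 1 0 (\<eta> 0)"
  proof (rule left_deriv_at_max[OF eta_gt[of 0], where f = "\<lambda>y. Du 2 0 0 y" and f' = "\<lambda>y. Du 2 1 0 y"])
    fix y assume "- d < y" "y < \<eta> 0"
    then show "((\<lambda>y. Du 2 0 0 y) has_real_derivative Du 2 1 0 y) (at y)" "Du 2 0 0 y \<le> Du 2 0 0 (\<eta> 0)"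
      using Du_y[of 2 0 0 y] uxx_axis[of y] uxx by (simp_all add: in_Om)
  qed (auto intro!: column_cont Du_cont)
  have uyy: "Du 0 2 0 (\<eta> 0) \<le> 0" using superharmonic_u[OF top_in_closure, of 0] uxx by simp
  \<comment> \<open>The value of K'' at 0; the terms with \<eta>', u_x, u_xx or u_xy as a factor
    have dropped out.\<close>
  let ?L = "deriv \<eta>' 0 * Du 0 1 0 (\<eta> 0) * (2 * Du 0 1 0 (\<eta> 0) + \<gamma> 0)
    + 2 * u 0 (\<eta> 0) * (Du 2 1 0 (\<eta> 0) + deriv \<eta>' 0 * Du 0 2 0 (\<eta> 0))"
  have D: "((\<lambda>t. Du 0 1 t (\<eta> t)) has_real_derivative Du 1 1 0 (\<eta> 0) + \<eta>' 0 * Du 0 2 0 (\<eta> 0)) (at 0)"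
    "((\<lambda>t. Du 1 1 t (\<eta> t)) has_real_derivative Du 2 1 0 (\<eta> 0) + \<eta>' 0 * Du 1 2 0 (\<eta> 0)) (at 0)"
    "((\<lambda>t. Du 0 2 t (\<eta> t)) has_real_derivative Du 1 2 0 (\<eta> 0) + \<eta>' 0 * Du 0 3 0 (\<eta> 0)) (at 0)"
    using Du_trace_deriv[of 0 1 0] Du_trace_deriv[of 1 1 0] Du_trace_deriv[of 0 2 0]
    by (simp_all add: numeral_2_eq_2 numeral_3_eq_3)
  have "((\<lambda>x. (Du 1 0 x (\<eta> x) + \<eta>' x * Du 0 1 x (\<eta> x)) * (2 * Du 0 1 x (\<eta> x) + \<gamma> 0)
    + 2 * u x (\<eta> x) * (Du 1 1 x (\<eta> x) + \<eta>' x * Du 0 2 x (\<eta> x))) has_real_derivative ?L) (at 0)"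
    by (rule derivative_eq_intros u_trace_deriv ux' D eta_deriv2 refl)+
      (use uxy_crest ux0 uxx in \<open>simp add: eta'_crest algebra_simps\<close>)
  then have "0 \<le> ?L"
    by (rule right_second_deriv_at_min[OF zero_less_one K_deriv, rotated])
      (use K_nonneg K0 uxy_crest ux0 in \<open>auto simp: eta'_crest\<close>)
  moreover have "deriv \<eta>' 0 * Du 0 1 0 (\<eta> 0) * (2 * Du 0 1 0 (\<eta> 0) + \<gamma> 0) < 0"
    using uy_sign[of 0] K0 eta''_crest[OF K0] by (simp add: mult_neg_pos)
  moreover have "u 0 (\<eta> 0) * (Du 2 1 0 (\<eta> 0) + deriv \<eta>' 0 * Du 0 2 0 (\<eta> 0)) \<le> 0"
    using U uxxy uyy eta''_crest[OF K0] by (intro mult_nonpos_nonneg add_nonneg_nonneg mult_nonpos_nonpos) auto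
  ultimately show False by linarith
qed

lemma strict:
  assumes "x \<ge> 0"
  shows "K x > 0" "N x > 0"
proof -
  have "K x > 0 \<and> N x > 0"
  proof (cases "x = 0")
    case True
    then show ?thesis
      using K_crest v_axis[of "\<eta> 0"] eta_gt[of 0] u_neg[OF top_in_closure, of 0] by (simp add: N_def)
  next
    case False
    then have x: "x > 0" using assms by simp
    have "N x \<noteq> 0" using ux_steepest[OF x] ux_top_neg[OF x] gamma0 by auto
    then have N: "N x > 0" using N_nonneg[of x] x by simp
    then have "v x (\<eta> x) * K x > 0" using N_ux[of x] mult_pos_neg[OF N ux_top_neg[OF x]] by simp
    then show ?thesis using v_top_pos[OF x] N by (simp add: zero_less_mult_iff)
  qed
  then show "K x > 0" "N x > 0" by auto
qed

end

section \<open>From the surface slope to the slope of all streamlines\<close>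

context monotone_solitary
begin

text \<open>q = v/u satisfies q_xx + q_yy + (2/u)(u_x q_x + u_y q_y) = 0. The weak principle yields
  only a nonstrict bound, so it is applied with the level 1 - \<delta>, where \<delta> is a uniform
  margin in \<eta>' > -1.\<close>

lemma slope_right_half:
  assumes N: "\<And>x. x \<ge> 0 \<Longrightarrow> N x > 0" and in_closure: "(x0, y0) \<in> closure \<Omega>" "x0 \<ge> 0"
  shows "\<bar>v x0 y0 / u x0 y0\<bar> < 1"
proof -
  obtain H where H: "\<And>x. \<eta> x \<le> H" using eta_bdd_above by blast
  obtain c where c: "c < 0" "\<And>x y. (x, y) \<in> closure \<Omega> \<Longrightarrow> u x y \<le> c" using u_bound by blast
  obtain B where B: "\<And>x y. (x, y) \<in> closure \<Omega> \<Longrightarrow> \<bar>Du 0 1 x y\<bar> \<le> B"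
    using Du_bdd[of 0 1] unfolding bounded_iff by fastforce
  have "((\<lambda>x. v x (\<eta> x) / u x (\<eta> x)) \<longlongrightarrow> 0 / wuinf w 0) at_top"
    using Dv_trace_lim[of 0 0] u_trace_lim[OF eta_nonneg] uinf_neg[OF eta_nonneg]
    by (intro tendsto_divide) (auto simp: Dv_00)
  then have "((\<lambda>x. 1 + \<eta>' x) \<longlongrightarrow> 1 + 0) at_top"
    by (intro tendsto_intros) (simp add: eta'_eq)
  moreover have "0 < 1 + \<eta>' x" if "x \<ge> 0" for x
  proof -
    have "\<bar>v x (\<eta> x)\<bar> < \<bar>u x (\<eta> x)\<bar>" using N[OF that] by (simp add: N_def flip: abs_le_square_iff not_le)
    then show ?thesis using u_neg[OF top_in_closure, of x] by (simp add: eta'_eq field_simps)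
  qed
  moreover have "continuous_on {0..} (\<lambda>x. 1 + \<eta>' x)" by (intro continuous_intros cont_eta')
  ultimately obtain \<delta> where \<delta>: "\<delta> > 0" "\<And>x. x \<ge> 0 \<Longrightarrow> \<delta> \<le> 1 + \<eta>' x"
    using positive_bounded_away[of 0 "\<lambda>x. 1 + \<eta>' x" "1 + 0"] by auto
  \<comment> \<open>Makes f \<le> 0 on the axis and the bottom, where v = 0, and leaves room at
    infinity.\<close>
  have \<delta>1: "\<delta> \<le> 1" using \<delta>(2)[of 0] by (simp add: eta'_crest)
  define f where "f x y = - (v x y / u x y) - (1 - \<delta>)" for x y
  define qx where "qx x y = (Dv 1 0 x y * u x y - v x y * Du 1 0 x y) / (u x y * u x y)" for x y
  define qy where "qy x y = (Dv 0 1 x y * u x y - v x y * Du 0 1 x y) / (u x y * u x y)" for x y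
  \<comment> \<open>The second derivatives of v/u, arranged so that the first-order term of the
    equation stands apart and the rest cancels by \<open>laplace_u\<close> and
    \<open>laplace_v\<close>.\<close>
  define qxx where "qxx x y = (Dv 2 0 x y * u x y - v x y * Du 2 0 x y) / (u x y * u x y)
    - 2 * Du 1 0 x y / u x y * qx x y" for x y
  define qyy where "qyy x y = (Dv 0 2 x y * u x y - v x y * Du 0 2 x y) / (u x y * u x y)
    - 2 * Du 0 1 x y / u x y * qy x y" for x y
  have "f x0 y0 \<le> 0"
  proof (rule weak_max_principle[OF cont_eta H, where d = d and f = f and A = "2 * B / \<bar>c\<bar>"
        and fx = "\<lambda>x y. - qx x y" and fy = "\<lambda>x y. - qy x y"
        and fxx = "\<lambda>x y. - qxx x y" and fyy = "\<lambda>x y. - qyy x y"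
        and b = "\<lambda>x y. 2 * Du 1 0 x y / u x y" and a = "\<lambda>x y. 2 * Du 0 1 x y / u x y"])
    show "continuous_on {p. 0 \<le> fst p \<and> - d \<le> snd p \<and> snd p \<le> \<eta> (fst p)} (\<lambda>p. f (fst p) (snd p))"
      unfolding f_def
      by (intro continuous_intros continuous_on_subset[OF Du_cont[of 0 0, unfolded Du_00]]
          continuous_on_subset[OF Dv_cont[of 0 0, unfolded Dv_00]])
        (use u_neg in \<open>fastforce simp: closure_Om\<close>)+
  next
    fix x y assume "0 < x \<and> - d < y \<and> y < \<eta> x"
    then have Om: "(x, y) \<in> \<Omega>" by (simp add: in_Om)
    have cl: "(x, y) \<in> closure \<Omega>" using Om_subset_closure[OF Om] .
    have U: "u x y < 0" by (rule u_neg[OF cl])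
    have D0: "((\<lambda>t. u t y) has_real_derivative Du 1 0 x y) (at x)" "((\<lambda>s. u x s) has_real_derivative Du 0 1 x y) (at y)"
      "((\<lambda>t. v t y) has_real_derivative Dv 1 0 x y) (at x)" "((\<lambda>s. v x s) has_real_derivative Dv 0 1 x y) (at y)"
      using Du_x[of 0 0 x y] Du_y[of 0 0 x y] Dv_x[of 0 0 x y] Dv_y[of 0 0 x y] Om by (simp_all add: Du_00 Dv_00)
    have D1: "((\<lambda>t. Du 1 0 t y) has_real_derivative Du 2 0 x y) (at x)" "((\<lambda>s. Du 0 1 x s) has_real_derivative Du 0 2 x y) (at y)"
      "((\<lambda>t. Dv 1 0 t y) has_real_derivative Dv 2 0 x y) (at x)" "((\<lambda>s. Dv 0 1 x s) has_real_derivative Dv 0 2 x y) (at y)"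
      using Du_x[of 1 0 x y] Du_y[of 0 1 x y] Dv_x[of 1 0 x y] Dv_y[of 0 1 x y] Om by (simp_all add: numeral_2_eq_2)
    show "((\<lambda>t. f t y) has_real_derivative - qx x y) (at x)" "((\<lambda>s. f x s) has_real_derivative - qy x y) (at y)"
      unfolding f_def qx_def qy_def
      using DERIV_diff[OF DERIV_minus[OF DERIV_divide[OF D0(3,1)]] DERIV_const, of "1 - \<delta>"]
        DERIV_diff[OF DERIV_minus[OF DERIV_divide[OF D0(4,2)]] DERIV_const, of "1 - \<delta>"] U by simp_all
    have "((\<lambda>t. qx t y) has_real_derivative qxx x y) (at x)" "((\<lambda>s. qy x s) has_real_derivative qyy x y) (at y)"
      unfolding qx_def qy_def qxx_def qyy_def
      by (rule derivative_eq_intros D0 D1 refl | use U in \<open>simp add: field_simps\<close>)+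
    then show "((\<lambda>t. - qx t y) has_real_derivative - qxx x y) (at x)" "((\<lambda>s. - qy x s) has_real_derivative - qyy x y) (at y)"
      by (auto intro: DERIV_minus)
    have "(Dv 2 0 x y + Dv 0 2 x y) * u x y - v x y * (Du 2 0 x y + Du 0 2 x y) = 0"
      unfolding laplace_u[OF Om] laplace_v[OF Om] by simp
    then have "qxx x y + qyy x y = - (2 * Du 1 0 x y / u x y * qx x y) - 2 * Du 0 1 x y / u x y * qy x y"
      unfolding qxx_def qyy_def by (simp add: algebra_simps flip: add_divide_distrib diff_divide_distrib)
    then show "0 \<le> - qxx x y + - qyy x y + 2 * Du 1 0 x y / u x y * - qx x y + 2 * Du 0 1 x y / u x y * - qy x y"
      by simp
    have "\<bar>Du 0 1 x y\<bar> / \<bar>u x y\<bar> \<le> B / \<bar>c\<bar>"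
      using B[OF cl] c(2)[OF cl] c(1) by (intro frac_le) auto
    then show "\<bar>2 * Du 0 1 x y / u x y\<bar> \<le> 2 * B / \<bar>c\<bar>" by (simp add: abs_mult abs_divide)
  next
    fix x y :: real assume "0 \<le> x" "- d \<le> y" "y \<le> \<eta> x" and "x = 0 \<or> y = - d \<or> y = \<eta> x"
    then show "f x y \<le> 0"
      using v_axis[of y] v_bottom[of x] \<delta>(2)[of x] \<delta>1 by (auto simp: f_def simp flip: eta'_eq)
  next
    fix e :: real assume "e > 0"
    then obtain R where R: "\<forall>x y i j. R < x \<and> (x, y) \<in> closure \<Omega> \<and> i + j \<le> 2 \<longrightarrow> \<bar>Dv i j x y\<bar> < e * \<bar>c\<bar>"
      using Dv_small[of "e * \<bar>c\<bar>"] c(1) by (metis mult_pos_pos zero_less_abs_iff less_irrefl)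
    have "f x y \<le> e" if "R < x" "- d \<le> y" "y \<le> \<eta> x" for x y
    proof -
      have cl: "(x, y) \<in> closure \<Omega>" using that by (simp add: closure_Om)
      have "\<bar>v x y\<bar> \<le> e * \<bar>c\<bar>" using R[rule_format, of x y 0 0] that cl by (simp add: Dv_00)
      also have "\<dots> \<le> e * \<bar>u x y\<bar>" using c(2)[OF cl] c(1) \<open>e > 0\<close> by (intro mult_left_mono) auto
      finally have "\<bar>v x y / u x y\<bar> \<le> e" using u_neg[OF cl] by (simp add: abs_divide field_simps)
      then show ?thesis using \<delta>1 unfolding f_def by linarith
    qed
    then show "\<exists>R. \<forall>x y. R < x \<and> - d \<le> y \<and> y \<le> \<eta> x \<longrightarrow> f x y \<le> e" by blast
  qed (use in_closure in \<open>auto simp: closure_Om\<close>)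
  \<comment> \<open>In this half v/u is nonpositive, so the bound on - v/u bounds its absolute
    value.\<close>
  moreover have "v x0 y0 / u x0 y0 \<le> 0"
    using v_nonneg[OF in_closure] u_neg[OF in_closure(1)] by (simp add: divide_nonneg_neg)
  ultimately show ?thesis using \<delta>(1) by (simp add: f_def)
qed

end

text \<open>The left half follows by reflection, as v/u is odd in x.\<close>

lemma (in solitary) slope_bound:
  assumes "monotone_wave w \<or> trivial_wave w" and N: "\<And>x. x \<ge> 0 \<Longrightarrow> N x > 0"
    and xy: "(x, y) \<in> closure \<Omega>"
  shows "\<bar>v x y / u x y\<bar> < 1"
  using assms(1)
proof
  assume "trivial_wave w"
  then show ?thesis using trivial_properties(2)[OF _ xy] by simp
next
  assume "monotone_wave w"
  then interpret monotone_solitary by unfold_locales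
  have "(- x, y) \<in> closure \<Omega>" using xy by (simp add: closure_Om eta_even)
  then show ?thesis
    using slope_right_half[OF N, of x y] slope_right_half[OF N, of "- x" y] symmetry[OF xy] xy by (cases "x \<ge> 0") auto
qed

section \<open>The continuity argument\<close>

lemma bounded_range_Pair:
  assumes "bounded (range f)" "bounded (range g)"
  shows "bounded (range (\<lambda>x. (f x, g x)))"
  by (rule bounded_subset[OF bounded_Times[OF assms]]) auto

text \<open>\<open>Bcontfun\<close> can be evaluated only on a continuous bounded function; both
  properties come from those of the derivatives on the closure of the domain.\<close>

lemma (in solitary) apply_tau:
  "apply_bcontfun (tau w) x = (let s = max 0 x; h = \<eta> s in
      (Du 0 0 s h, Dv 0 0 s h, Du 1 0 s h, Dv 1 0 s h, Du 0 1 s h, Du 2 0 s h, Du 1 1 s h))"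
proof -
  have c: "continuous_on UNIV (\<lambda>x. D i j (max 0 x) (\<eta> (max 0 x)))"
    and b: "bounded (range (\<lambda>x. D i j (max 0 x) (\<eta> (max 0 x))))"
    if D: "Ck_fam 3 \<Omega> f D" "i + j \<le> 3" for f D i j
  proof -
    show "continuous_on UNIV (\<lambda>x. D i j (max 0 x) (\<eta> (max 0 x)))"
      by (rule continuous_on_compose2[OF trace_cont[OF Ck_famD(4)[OF D], of UNIV]]) (auto intro!: continuous_intros)
    show "bounded (range (\<lambda>x. D i j (max 0 x) (\<eta> (max 0 x))))"
      by (rule bounded_subset[OF Ck_famD(5)[OF D]]) (use top_in_closure in force)
  qed
  show ?thesis
    unfolding tau_def Let_def
    by (subst Bcontfun_inverse)
      (auto simp: bcontfun_def intro!: continuous_intros bounded_range_Pair c[OF fam_u] c[OF fam_v] b[OF fam_u] b[OF fam_v])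
qed

lemma continuous_on_apply_bcontfun_at:
  fixes F :: "'b::metric_space \<Rightarrow> real"
  assumes "continuous_on UNIV F"
  shows "continuous_on A (\<lambda>\<phi> :: ('a::topological_space, 'b) bcontfun. F (apply_bcontfun \<phi> x))"
proof -
  have "continuous_on A (\<lambda>\<phi> :: ('a, 'b) bcontfun. apply_bcontfun \<phi> x)"
    unfolding continuous_on_iff using dist_fun_lt_imp_dist_val_lt by blast
  then show ?thesis
    using continuous_on_compose[of A "\<lambda>\<phi>. apply_bcontfun \<phi> x" F] continuous_on_subset[OF assms]
    by (simp add: o_def)
qed

lemma closed_nonneg_at:
  fixes F :: "'b::metric_space \<Rightarrow> real"
  assumes "continuous_on UNIV F"
  shows "closed {\<phi> :: ('a::topological_space, 'b) bcontfun. 0 \<le> F (apply_bcontfun \<phi> x)}"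
  by (rule closed_Collect_le[OF continuous_on_const continuous_on_apply_bcontfun_at[OF assms]])

text \<open>\<phi> has bounded range. Functions closer than 1 to it stay in a compact ball of radius
  enlarged by 1, where F is uniformly continuous and so changes by less than \<delta>.\<close>

lemma open_uniformly_positive:
  fixes F :: "'b::{metric_space, heine_borel} \<Rightarrow> real" and \<phi> :: "('a::topological_space, 'b) bcontfun"
  assumes F: "continuous_on UNIV F" and "\<delta> > 0" and \<delta>: "\<And>x. \<delta> \<le> F (\<phi> x)"
  shows "\<exists>\<epsilon>>0. \<forall>\<phi>'. dist \<phi>' \<phi> < \<epsilon> \<longrightarrow> (\<forall>x. 0 < F (\<phi>' x))"
proof -
  obtain a R where R: "\<And>x. dist a (\<phi> x) \<le> R"
    using bounded_apply_bcontfun[of \<phi>] unfolding bounded_def by auto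
  have "uniformly_continuous_on (cball a (R + 1)) F"
    by (intro compact_uniformly_continuous continuous_on_subset[OF F]) auto
  then obtain \<epsilon> where \<epsilon>: "\<epsilon> > 0" "\<And>p q. p \<in> cball a (R + 1) \<Longrightarrow> q \<in> cball a (R + 1) \<Longrightarrow> dist q p < \<epsilon> \<Longrightarrow> dist (F q) (F p) < \<delta>"
    using \<open>\<delta> > 0\<close> unfolding uniformly_continuous_on_def by metis
  show ?thesis
  proof (intro exI[of _ "min \<epsilon> 1"] conjI allI impI)
    fix \<phi>' x assume "dist \<phi>' \<phi> < min \<epsilon> 1"
    then have d: "dist (\<phi>' x) (\<phi> x) < \<epsilon>" "dist (\<phi>' x) (\<phi> x) < 1"
      using dist_fun_lt_imp_dist_val_lt by (metis min_less_iff_conj)+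
    have "dist a (\<phi>' x) \<le> R + 1"
      using dist_triangle[of a "\<phi>' x" "\<phi> x"] R[of x] d(2) by (simp add: dist_commute)
    then have "dist (F (\<phi>' x)) (F (\<phi> x)) < \<delta>"
      using \<epsilon>(2)[of "\<phi> x" "\<phi>' x"] R[of x] d(1) by simp
    then show "0 < F (\<phi>' x)" using \<delta>[of x] by (simp add: dist_real_def abs_if split: if_splits)
  qed (use \<epsilon>(1) in simp)
qed

text \<open>K and N as functions of a single value of \<open>tau\<close>, so that their signs make
  sense for every element of the function space and not only for images of waves.\<close>

fun K_tau :: "real \<Rightarrow> tau_val \<Rightarrow> real" where
  "K_tau g (u, v, ux, vx, uy, uxx, uxy) = g + u * (uy + vx)"

fun N_tau :: "tau_val \<Rightarrow> real" where
  "N_tau (u, v, ux, vx, uy, uxx, uxy) = u\<^sup>2 - v\<^sup>2"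

lemma K_tau_cont: "continuous_on A (K_tau g)" and N_tau_cont: "continuous_on A N_tau"
proof -
  have "K_tau g = (\<lambda>p. g + fst p * (fst (snd (snd (snd (snd p)))) + fst (snd (snd (snd p)))))"
    "N_tau = (\<lambda>p. (fst p)\<^sup>2 - (fst (snd p))\<^sup>2)" by auto
  note eq = this
  show "continuous_on A (K_tau g)" "continuous_on A N_tau"
    unfolding eq by (intro continuous_intros)+
qed

lemma (in solitary) K_tau: "K_tau g (tau w x) = K (max 0 x)" and N_tau: "N_tau (tau w x) = N (max 0 x)"
  by (simp_all add: apply_tau Let_def K_def N_def Du_00 Dv_00)

theorem theorem4p2:
  fixes g Patm :: real and C :: "wave set"
  assumes "g > 0"
    and "C \<subseteq> Wcal g Patm"
    and "connected (tau ` C)"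
    and "\<exists>w \<in> C. trivial_wave w"
    and "\<forall>w \<in> C. \<forall>\<psi> m \<gamma>. stream_vort w \<psi> m \<gamma> \<longrightarrow> g - \<gamma> 0 * wuinf w 0 > 0"
  shows "\<forall>w \<in> C. \<forall>x y. (x, y) \<in> closure (Om w) \<longrightarrow> \<bar>wv w x y / wu w x y\<bar> < 1"
proof -
  have wave: "\<exists>\<psi> m \<gamma>. solitary g Patm w \<psi> m \<gamma>" and kind: "monotone_wave w \<or> trivial_wave w"
    if "w \<in> C" for w
    using that assms unfolding Wcal_def solitary_def by blast+
  \<comment> \<open>The positivity of K and N and its closed counterpart, stated for arbitrary
    functions; the two sets agree on the image of C.\<close>
  define S where "S = {\<phi> :: (real, tau_val) bcontfun. \<forall>x. 0 < K_tau g (apply_bcontfun \<phi> x) \<and> 0 < N_tau (apply_bcontfun \<phi> x)}"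
  define S' where "S' = {\<phi> :: (real, tau_val) bcontfun. \<forall>x. 0 \<le> K_tau g (apply_bcontfun \<phi> x) \<and> 0 \<le> N_tau (apply_bcontfun \<phi> x)}"
  \<comment> \<open>The extension by \<open>max 0 x\<close> repeats the value at 0 for negative x,
    so quantifying over the line amounts to quantifying over the half-line.\<close>
  have S_iff: "tau w \<in> S \<longleftrightarrow> (\<forall>x\<ge>0. 0 < solitary.K g w x \<and> 0 < solitary.N w x)"
    and S'_iff: "tau w \<in> S' \<longleftrightarrow> (\<forall>x\<ge>0. 0 \<le> solitary.K g w x \<and> 0 \<le> solitary.N w x)"
    if "solitary g Patm w \<psi> m \<gamma>" for w \<psi> m \<gamma>
  proof -
    interpret solitary g Patm w \<psi> m \<gamma> by (rule that)
    show "tau w \<in> S \<longleftrightarrow> (\<forall>x\<ge>0. 0 < K x \<and> 0 < N x)" "tau w \<in> S' \<longleftrightarrow> (\<forall>x\<ge>0. 0 \<le> K x \<and> 0 \<le> N x)"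
      unfolding S_def S'_def mem_Collect_eq K_tau N_tau by (metis max.absorb2 max.cobounded1)+
  qed
  have limit: "tau w \<in> S" if w: "w \<in> C" and S': "tau w \<in> S'" for w
  proof -
    obtain \<psi> m \<gamma> where sol: "solitary g Patm w \<psi> m \<gamma>" using wave[OF w] by blast
    interpret solitary g Patm w \<psi> m \<gamma> by (rule sol)
    show ?thesis
      using kind[OF w]
    proof
      assume "monotone_wave w"
      then interpret limit_solitary g Patm w \<psi> m \<gamma>
        by unfold_locales (use S'_iff[OF sol] S' in auto)
      show ?thesis using strict S_iff[OF sol] by blast
    next
      assume "trivial_wave w"
      then show ?thesis using trivial_properties(3,4) S_iff[OF sol] by blast
    qed
  qed
  have nearby: "\<exists>\<epsilon>>0. \<forall>\<phi>. dist \<phi> (tau w) < \<epsilon> \<longrightarrow> \<phi> \<in> S" if w: "w \<in> C" and S: "tau w \<in> S" for w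
  proof -
    obtain \<psi> m \<gamma> where sol: "solitary g Patm w \<psi> m \<gamma>" using wave[OF w] by blast
    interpret solitary g Patm w \<psi> m \<gamma> by (rule sol)
    have "\<eta> x \<ge> 0" if "x \<ge> 0" for x
      using kind[OF w]
    proof
      assume "monotone_wave w"
      then interpret monotone_solitary g Patm w \<psi> m \<gamma> by unfold_locales
      show ?thesis by (rule eta_nonneg[OF that])
    next
      assume "trivial_wave w"
      then show ?thesis using trivial_properties(1) by simp
    qed
    from uniformly_positive[OF this] obtain \<delta> where \<delta>: "\<delta> > 0" "\<And>x. x \<ge> 0 \<Longrightarrow> \<delta> \<le> K x \<and> \<delta> \<le> N x"
      using S S_iff[OF sol] by blast
    have "\<delta> \<le> K_tau g (tau w x)" "\<delta> \<le> N_tau (tau w x)" for x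
      using \<delta>(2)[of "max 0 x"] by (simp_all add: K_tau N_tau)
    from open_uniformly_positive[OF K_tau_cont \<delta>(1) this(1)] open_uniformly_positive[OF N_tau_cont \<delta>(1) this(2)]
    obtain \<epsilon>1 \<epsilon>2 where "\<epsilon>1 > 0" "\<epsilon>2 > 0"
      "\<And>\<phi> x. dist \<phi> (tau w) < \<epsilon>1 \<Longrightarrow> 0 < K_tau g (apply_bcontfun \<phi> x)"
      "\<And>\<phi> x. dist \<phi> (tau w) < \<epsilon>2 \<Longrightarrow> 0 < N_tau (apply_bcontfun \<phi> x)" by blast
    then show ?thesis by (intro exI[of _ "min \<epsilon>1 \<epsilon>2"]) (auto simp: S_def)
  qed
  let ?T = "tau ` C"
  have "closed S'" unfolding S'_def
    by (intro closed_Collect_all closed_Collect_conj closed_nonneg_at K_tau_cont N_tau_cont)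
  moreover have "S \<subseteq> S'" unfolding S_def S'_def by (blast intro: less_imp_le)
  then have "?T \<inter> S = ?T \<inter> S'" using limit by blast
  ultimately have "closedin (top_of_set ?T) (?T \<inter> S)" by (simp add: closedin_closed_Int)
  \<comment> \<open>Relative openness needs a neighbourhood in \<open>S\<close> only around points
    of the image, which \<open>nearby\<close> provides.\<close>
  moreover have "openin (top_of_set ?T) (?T \<inter> S)"
    unfolding openin_euclidean_subtopology_iff using nearby by blast
  moreover have "?T \<inter> S \<noteq> {}"
  proof -
    obtain w where w: "w \<in> C" "trivial_wave w" using assms(4) by blast
    obtain \<psi> m \<gamma> where sol: "solitary g Patm w \<psi> m \<gamma>" using wave[OF w(1)] by blast
    interpret solitary g Patm w \<psi> m \<gamma> by (rule sol)
    have "tau w \<in> S" using S_iff[OF sol] trivial_properties(3,4)[OF w(2)] by blast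
    then show ?thesis using w(1) by blast
  qed
  ultimately have all: "?T \<inter> S = ?T" using assms(3) unfolding connected_clopen by blast
  show ?thesis
  proof (intro ballI allI impI)
    fix w x y assume w: "w \<in> C" and xy: "(x, y) \<in> closure (Om w)"
    obtain \<psi> m \<gamma> where sol: "solitary g Patm w \<psi> m \<gamma>" using wave[OF w] by blast
    interpret solitary g Patm w \<psi> m \<gamma> by (rule sol)
    have "tau w \<in> S" using all w by blast
    then show "\<bar>v x y / u x y\<bar> < 1"
      using slope_bound[OF kind[OF w] _ xy] S_iff[OF sol] by blast
  qed
qed

end
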